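(* Let $(X,\lambda)$ be a standard $\sigma$-finite space, let $G$ be a locally compact Polish group and let $\alpha: G\times X\to X$ be a (spatial) measure-preserving $G$-action on $(X,\lambda)$. Then there exist a locally compact Polish space $Y$, a continuous $G$-action $\beta:G\times Y\to Y$ and a Borel injection $\Phi:X\to Y$, such that $\Phi(\alpha(g,x))=\beta(g,\Phi(x))$ for all $g\in G$ and all $x\in X$, the pushforward measure $\Phi_*\lambda$ is a Radon measure on $Y$, and $\beta$ preserves the measure $\Phi_*\lambda$.
   Context: A standard Borel space is an uncountable measurable space whose $\sigma$-algebra is the Borel $\sigma$-algebra of some Polish topology. A standard $\sigma$-finite space $(X,\lambda)$ is a standard Borel space $X$ with a nontrivial (nonzero) atomless $\sigma$-finite Borel measure $\lambda$. A (spatial) measure-preserving $G$-action of a Polish group $G$ on $(X,\lambda)$ is a Borel map $\alpha:G\times X\to X$ which is a genuine group action and such that each $\alpha(g,\cdot)$ is a Borel bijection preserving $\lambda$. An action on a topological space $Y$ is continuous if the action map $G\times Y\to Y$ is continuous. A Borel measure on a Hausdorff space is Radon if it is finite on compact sets, inner regular (by compact sets) on open sets, and outer regular (by open sets) on Borel sets; on a locally compact Polish space this is equivalent to every point having an open neighborhood of finite measure. *)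

theory Defs
  imports "HOL-Analysis.Analysis" "HOL-Algebra.Group_Action"
begin

definition polish_topology :: "'a topology \<Rightarrow> bool" where
  "polish_topology T \<longleftrightarrow> completely_metrizable_space T \<and> separable_space T"

definition borel_of :: "'a topology \<Rightarrow> 'a measure" where
  "borel_of T = sigma (topspace T) {U. openin T U}"

text \<open>Standard Borel spaces are required to be uncountable.\<close>

definition standard_borel_space :: "'a measure \<Rightarrow> bool" where
  "standard_borel_space M \<longleftrightarrow>
     uncountable (space M) \<and>
     (\<exists>T. polish_topology T \<and> topspace T = space M \<and> sets M = sets (borel_of T))"

definition atomless_measure :: "'a measure \<Rightarrow> bool" where
  "atomless_measure M \<longleftrightarrow>
     (\<forall>A\<in>sets M. 0 < emeasure M A \<longrightarrow>
        (\<exists>B\<in>sets M. B \<subseteq> A \<and> 0 < emeasure M B \<and> emeasure M B < emeasure M A))"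

definition standard_sigma_finite_space :: "'a measure \<Rightarrow> bool" where
  "standard_sigma_finite_space M \<longleftrightarrow>
     standard_borel_space M \<and> sigma_finite_measure M \<and>
     emeasure M (space M) \<noteq> 0 \<and> atomless_measure M"

definition topological_group :: "('g, 'm) monoid_scheme \<Rightarrow> 'g topology \<Rightarrow> bool" where
  "topological_group G T \<longleftrightarrow>
     group G \<and> topspace T = carrier G \<and>
     continuous_map (prod_topology T T) T (\<lambda>(g, h). g \<otimes>\<^bsub>G\<^esub> h) \<and>
     continuous_map T T (\<lambda>g. inv\<^bsub>G\<^esub> g)"

definition polish_group :: "('g, 'm) monoid_scheme \<Rightarrow> 'g topology \<Rightarrow> bool" where
  "polish_group G T \<longleftrightarrow> topological_group G T \<and> polish_topology T"

definition measure_preserving :: "'a measure \<Rightarrow> ('a \<Rightarrow> 'a) \<Rightarrow> bool" where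
  "measure_preserving M f \<longleftrightarrow> f \<in> M \<rightarrow>\<^sub>M M \<and> distr M M f = M"

text \<open>In \<^const>\<open>group_action\<close> each \<open>\<alpha> g\<close> is a bijection of the space that is, by convention,
  \<^const>\<open>undefined\<close> outside of it; the action laws hold at every point, not just almost everywhere.\<close>

definition measure_preserving_action ::
  "('g, 'm) monoid_scheme \<Rightarrow> 'g topology \<Rightarrow> 'a measure \<Rightarrow> ('g \<Rightarrow> 'a \<Rightarrow> 'a) \<Rightarrow> bool" where
  "measure_preserving_action G T M \<alpha> \<longleftrightarrow>
     group_action G (space M) \<alpha> \<and>
     (\<lambda>(g, x). \<alpha> g x) \<in> borel_of T \<Otimes>\<^sub>M M \<rightarrow>\<^sub>M M \<and>
     (\<forall>g\<in>carrier G. measure_preserving M (\<alpha> g))"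

definition continuous_action ::
  "('g, 'm) monoid_scheme \<Rightarrow> 'g topology \<Rightarrow> 'a topology \<Rightarrow> ('g \<Rightarrow> 'a \<Rightarrow> 'a) \<Rightarrow> bool" where
  "continuous_action G T Y \<beta> \<longleftrightarrow>
     group_action G (topspace Y) \<beta> \<and>
     continuous_map (prod_topology T Y) Y (\<lambda>(g, y). \<beta> g y)"

definition radon_measure :: "'a topology \<Rightarrow> 'a measure \<Rightarrow> bool" where
  "radon_measure Y \<mu> \<longleftrightarrow>
     Hausdorff_space Y \<and> space \<mu> = topspace Y \<and> sets \<mu> = sets (borel_of Y) \<and>
     (\<forall>K. compactin Y K \<longrightarrow> emeasure \<mu> K < \<infinity>) \<and>
     (\<forall>U. openin Y U \<longrightarrow> emeasure \<mu> U = (SUP K\<in>{K. compactin Y K \<and> K \<subseteq> U}. emeasure \<mu> K)) \<and>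
     (\<forall>A\<in>sets \<mu>. emeasure \<mu> A = (INF U\<in>{U. openin Y U \<and> A \<subseteq> U}. emeasure \<mu> U))"

text \<open>Existential quantification over types is not available, so an existential over Polish spaces
  is taken over Polish topologies whose underlying set is a set of reals. By the
  following fact this covers every Polish space up to homeomorphism.\<close>

lemma polish_topology_homeomorphic_real:
  fixes Y :: "'a topology"
  assumes "polish_topology Y"
  obtains Z :: "real topology" where "Y homeomorphic_space Z" "polish_topology Z"
proof -
  obtain S d where "Metric_space S d" and Yd: "Y = Metric_space.mtopology S d"
    using assms unfolding polish_topology_def completely_metrizable_space_def by blast
  then interpret Metric_space S d by simp
  obtain C where "countable C" and CS: "C \<subseteq> S" and dense: "Abstract_Topology.closure_of mtopology C = S"
    using assms by (auto simp: polish_topology_def separable_space_def Yd)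
  define e :: "nat \<Rightarrow> 'a" where "e = from_nat_into C"
  define code :: "'a \<Rightarrow> nat set" where
    "code x = {n. d x (e (fst (prod_decode n))) < inverse (Suc (snd (prod_decode n)))}" for x
  have "inj_on code S"
  proof (rule inj_onI, rule ccontr)
    fix x y assume xS: "x \<in> S" and yS: "y \<in> S" and eq: "code x = code y" and "x \<noteq> y"
    then have "d x y / 2 > 0" by simp
    then obtain k where k: "inverse (Suc k) < d x y / 2"
      using reals_Archimedean by blast
    have "x \<in> Abstract_Topology.closure_of mtopology C" using xS dense by simp
    moreover have "0 < inverse (real (Suc k))" by simp
    ultimately obtain c where c: "c \<in> C" "c \<in> mball x (inverse (Suc k))"
      unfolding metric_closure_of by blast
    then obtain i where i: "e i = c"
      using from_nat_into_surj[OF \<open>countable C\<close> c(1)] unfolding e_def by blast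
    have x: "d x c < inverse (Suc k)" using c by simp
    then have "prod_encode (i, k) \<in> code x" by (simp add: code_def i)
    then have y: "d y c < inverse (Suc k)" unfolding eq by (simp add: code_def i)
    have "d x y \<le> d x c + d y c"
      using triangle[of x c y] commute[of c y] xS yS c CS by auto
    with x y k show False by simp
  qed
  moreover obtain h :: "nat set \<Rightarrow> real" where "inj h"
    using nat_sets_eqpoll_reals unfolding eqpoll_def using bij_betw_imp_inj_on by blast
  ultimately have inj: "inj_on (h \<circ> code) (topspace Y)"
    by (simp add: Yd comp_inj_on inj_on_subset)
  define f where "f = h \<circ> code"
  define g where "g = inv_into (topspace Y) f"
  define Z where "Z = pullback_topology (f ` topspace Y) g Y"
  have gf: "g (f x) = x" if "x \<in> topspace Y" for x
    using that inj by (simp add: f_def g_def del: comp_apply)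
  have "homeomorphic_maps Y Z f g"
    unfolding homeomorphic_maps_def
  proof (intro conjI ballI)
    have "continuous_map Y Y (g \<circ> f)"
      by (rule continuous_map_eq[OF continuous_map_id]) (simp add: gf)
    then show "continuous_map Y Z f"
      unfolding Z_def by (rule continuous_map_pullback') auto
    show "continuous_map Z Y g"
      using continuous_map_pullback[OF continuous_map_id, of "f ` topspace Y" g Y]
      by (simp add: Z_def id_def comp_def)
  qed (auto simp: gf Z_def topspace_pullback_topology)
  then have "Y homeomorphic_space Z"
    unfolding homeomorphic_space_def by blast
  with assms show ?thesis
    using that homeomorphic_completely_metrizable_space homeomorphic_separable_space
    unfolding polish_topology_def by blast
qed

end

theory Submission
  imports Defs
begin

text \<open>Let \<open>\<mu>\<close> be a right Haar measure on the group, let \<open>V m\<close> run through a countable base of open sets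
  of finite Haar measure and let \<open>A n\<close> be countably many sets of finite measure covering \<open>X\<close> and
  separating its points. The function \<open>h \<mapsto> \<mu> {g \<in> V m h. g x \<in> A n}\<close> on the group has modulus of
  continuity \<open>\<mu> (V m h \<triangle> V m h')\<close>, independent of \<open>x\<close>, and translating \<open>x\<close> by \<open>k\<close> amounts to
  replacing \<open>h\<close> by \<open>h k\<close>. All functions with this modulus of continuity form a compact metrizable
  space on which the group acts continuously; \<open>Y\<close> is its complement of the zero function, an open
  invariant set. The embedding is injective because these numbers determine, for almost every \<open>g\<close>,
  which \<open>A n\<close> contain \<open>g x\<close>, hence determine \<open>g x\<close> for some \<open>g\<close>. By Fubini every coordinate is
  integrable over \<open>X\<close>, so Markov's inequality bounds the measure of the open sets on which a
  coordinate exceeds a positive constant; these sets cover \<open>Y\<close>, so compact sets have finite measure.\<close>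

section \<open>Borel measures on metrizable spaces\<close>

text \<open>Orbit maps \<open>g \<mapsto> g x\<close> are merely Borel, so membership of
  \<open>g x\<close> in \<open>A n\<close> need not vary continuously with \<open>g\<close>.
  Measuring it inside the translates \<open>V m h\<close> smooths it, because translation of a set
  of finite Haar measure is continuous in measure. A modulus common to all points does two jobs: it
  reduces the functions to countably many coordinates, and it makes the action jointly continuous.
  The compact space itself cannot serve as \<open>Y\<close>: when the measure of \<open>X\<close> is
  infinite, a Radon image would have to be finite on all of it. Infinite mass can only gather where
  no coordinate stays away from zero, that is at the zero function, a single fixed point of the
  action. No point of \<open>X\<close> is mapped there, since the \<open>A n\<close> cover
  \<open>X\<close>. Right invariance is forced by the left action: the \<open>g\<close> with
  \<open>g (k x)\<close> in \<open>A n\<close> are those with \<open>g k\<close> in the set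
  belonging to \<open>x\<close>.\<close>

lemma space_borel_of [simp]: "space (borel_of X) = topspace X"
  unfolding borel_of_def by (rule space_measure_of) (use openin_subset in auto)

lemma sets_borel_of: "sets (borel_of X) = sigma_sets (topspace X) {U. openin X U}"
  unfolding borel_of_def by (rule sets_measure_of) (use openin_subset in auto)

lemma borel_of_openin: "openin X U \<Longrightarrow> U \<in> sets (borel_of X)"
  unfolding sets_borel_of by blast

lemma borel_of_closedin: "closedin X C \<Longrightarrow> C \<in> sets (borel_of X)"
  using sets.compl_sets[OF borel_of_openin, of X "topspace X - C"]
  by (auto simp: closedin_def double_diff)

lemma continuous_map_borel_measurable:
  assumes "continuous_map X Y f"
  shows "f \<in> borel_of X \<rightarrow>\<^sub>M borel_of Y"
  using assms unfolding borel_of_def[of Y]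
  by (intro measurable_sigma_sets[OF sets_measure_of])
    (auto dest: openin_subset openin_continuous_map_preimage intro!: borel_of_openin simp: continuous_map_def)

text \<open>\<open>P\<close> is a notion of smallness: having finite Haar measure, or lying in a
  compact set. As \<open>P\<close> holds locally and passes to open subsets, the basic sets with
  \<open>P\<close> still form a base, and their finite intersections keep \<open>P\<close>.
  Stability under intersection makes the base a generator on which measures can be compared.\<close>

lemma second_countable_Int_stable_base:
  assumes "second_countable X"
    and ex: "\<And>x. x \<in> topspace X \<Longrightarrow> \<exists>U. openin X U \<and> x \<in> U \<and> P U"
    and mono: "\<And>U V. openin X U \<Longrightarrow> openin X V \<Longrightarrow> V \<subseteq> U \<Longrightarrow> P U \<Longrightarrow> P V"
    and "P {}"
  obtains W :: "nat \<Rightarrow> 'a set" where "\<And>n. openin X (W n)" "\<And>n. P (W n)" "Int_stable (range W)"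
    "\<And>U x. openin X U \<Longrightarrow> x \<in> U \<Longrightarrow> \<exists>n. x \<in> W n \<and> W n \<subseteq> U"
proof -
  obtain \<B> where \<B>: "countable \<B>" "\<forall>V\<in>\<B>. openin X V"
    "\<forall>U x. openin X U \<and> x \<in> U \<longrightarrow> (\<exists>V \<in> \<B>. x \<in> V \<and> V \<subseteq> U)"
    using assms(1) unfolding second_countable_def by (elim exE conjE)
  define \<C> where "\<C> = {V\<in>\<B>. P V}"
  (* the empty set is adjoined to make the family nonempty, so that it is the range of a sequence *)
  define \<W> where "\<W> = insert {} (Inter ` {\<F>. finite \<F> \<and> \<F> \<subseteq> \<C> \<and> \<F> \<noteq> {}})"
  have "countable \<C>" using \<B>(1) by (simp add: \<C>_def)
  then have "countable {\<F>. finite \<F> \<and> \<F> \<subseteq> \<C>}" by (rule countable_Collect_finite_subset)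
  then have "countable {\<F>. finite \<F> \<and> \<F> \<subseteq> \<C> \<and> \<F> \<noteq> {}}"
    by (rule countable_subset[rotated]) auto
  then have "countable \<W>" by (simp add: \<W>_def)
  moreover have "\<W> \<noteq> {}" by (simp add: \<W>_def)
  ultimately have range: "range (from_nat_into \<W>) = \<W>" by (simp add: range_from_nat_into)
  have "openin X V \<and> P V" if "V \<in> \<W>" for V
  proof (cases "V = {}")
    case False
    with that obtain \<F> where \<F>: "finite \<F>" "\<F> \<subseteq> \<C>" "\<F> \<noteq> {}" "V = \<Inter>\<F>"
      by (auto simp: \<W>_def)
    then obtain U where U: "U \<in> \<F>" by blast
    have "openin X V" unfolding \<F>(4) using \<F> \<B>(2) by (intro openin_Inter) (auto simp: \<C>_def)
    moreover have "openin X U" "P U" "V \<subseteq> U" using U \<F> \<B>(2) by (auto simp: \<C>_def)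
    ultimately show ?thesis using mono by metis
  qed (simp add: \<open>P {}\<close>)
  then have W: "openin X (from_nat_into \<W> n)" "P (from_nat_into \<W> n)" for n
    using range by blast+
  have stable: "Int_stable \<W>"
  proof (rule Int_stableI)
    fix U V assume UV: "U \<in> \<W>" "V \<in> \<W>"
    show "U \<inter> V \<in> \<W>"
    proof (cases "U = {} \<or> V = {}")
      case False
      with UV obtain \<F> \<G> where "finite \<F>" "\<F> \<subseteq> \<C>" "\<F> \<noteq> {}" "U = \<Inter>\<F>"
        "finite \<G>" "\<G> \<subseteq> \<C>" "\<G> \<noteq> {}" "V = \<Inter>\<G>"
        by (auto simp: \<W>_def)
      then show ?thesis
        unfolding \<W>_def by (intro insertI2 image_eqI[of _ _ "\<F> \<union> \<G>"]) auto
    qed (auto simp: \<W>_def)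
  qed
  have base: "\<exists>n. x \<in> from_nat_into \<W> n \<and> from_nat_into \<W> n \<subseteq> U" if U: "openin X U" "x \<in> U" for U x
  proof -
    have "x \<in> topspace X" using openin_subset[OF U(1)] U(2) by blast
    then obtain U' where U': "openin X U'" "x \<in> U'" "P U'" using ex by metis
    have "openin X (U \<inter> U')" "x \<in> U \<inter> U'" using U U' by auto
    then obtain V where V: "V \<in> \<B>" "x \<in> V" "V \<subseteq> U \<inter> U'" using \<B>(3) by metis
    then have "V \<in> \<C>" unfolding \<C>_def using \<B>(2) U' mono[of U' V] by simp
    then have "V \<in> \<W>" unfolding \<W>_def by (intro insertI2 image_eqI[of _ _ "{V}"]) auto
    then obtain n where "V = from_nat_into \<W> n" using range by blast
    with V show ?thesis by auto
  qed
  show ?thesis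
    by (rule that[of "from_nat_into \<W>"]) (use W stable range base in auto)
qed

text \<open>An open set is the union of the basic sets inside it, and there are only countably
  many.\<close>

lemma sets_borel_of_base:
  assumes W: "\<And>n::nat. openin X (W n)"
    and base: "\<And>U x. openin X U \<Longrightarrow> x \<in> U \<Longrightarrow> \<exists>n. x \<in> W n \<and> W n \<subseteq> U"
  shows "sets (borel_of X) = sigma_sets (topspace X) (range W)"
  unfolding sets_borel_of
proof (rule sigma_sets_eqI)
  fix U assume "U \<in> {U. openin X U}"
  then have "U = (\<Union>n\<in>{n. W n \<subseteq> U}. W n)" using base by blast
  moreover have "(\<Union>n\<in>{n. W n \<subseteq> U}. W n) \<in> sigma_sets (topspace X) (range W)"
    by (rule sigma_sets_UNION) auto
  ultimately show "U \<in> sigma_sets (topspace X) (range W)" by simp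
qed (use W in blast)

lemma metrizable_separable_imp_second_countable:
  assumes "metrizable_space X" "separable_space X"
  shows "second_countable X"
proof -
  obtain S d where "Metric_space S d" and X: "X = Metric_space.mtopology S d"
    using assms unfolding metrizable_space_def by blast
  then interpret Metric_space S d by simp
  obtain C where C: "countable C" "C \<subseteq> S" and dense: "X closure_of C = S"
    using assms by (auto simp: separable_space_def X)
  define \<B> where "\<B> = (\<lambda>(c, n). mball c (inverse (real (Suc n)))) ` (C \<times> (UNIV :: nat set))"
  have "\<exists>V\<in>\<B>. x \<in> V \<and> V \<subseteq> U" if U: "openin X U" "x \<in> U" for U x
  proof -
    obtain r where r: "r > 0" "mball x r \<subseteq> U" and xS: "x \<in> S"
      using U unfolding X openin_mtopology by blast
    \<comment> \<open>With a radius below \<open>r / 2\<close>, a ball around a nearby point of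
      \<open>C\<close> that contains \<open>x\<close> stays within distance \<open>r\<close> of
      \<open>x\<close>.\<close>
    obtain n where n: "inverse (real (Suc n)) < r / 2"
      using r(1) reals_Archimedean[of "r/2"] by auto
    have "x \<in> Abstract_Topology.closure_of mtopology C" using xS dense X by simp
    moreover have "0 < inverse (real (Suc n))" by simp
    ultimately obtain c where c: "c \<in> C" "c \<in> mball x (inverse (Suc n))"
      unfolding metric_closure_of by blast
    have cS: "c \<in> S" using c C by blast
    have "x \<in> mball c (inverse (Suc n))"
      using c xS cS by (simp add: commute)
    moreover have "mball c (inverse (Suc n)) \<subseteq> U"
    proof
      fix y assume y: "y \<in> mball c (inverse (Suc n))"
      then have "d x y \<le> d x c + d c y" using triangle[of x c y] xS cS by auto
      also have "\<dots> < r" using y c n by auto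
      finally show "y \<in> U" using r(2) y xS by auto
    qed
    ultimately show ?thesis using c(1) unfolding \<B>_def by force
  qed
  moreover have "countable \<B>" using C unfolding \<B>_def by (intro countable_image countable_SIGMA) auto
  moreover have "\<forall>V\<in>\<B>. openin X V" by (auto simp: \<B>_def X)
  ultimately show ?thesis unfolding second_countable_def by blast
qed

lemma polish_topology_metrizable: "polish_topology X \<Longrightarrow> metrizable_space X"
  by (simp add: polish_topology_def completely_metrizable_imp_metrizable_space)

lemma polish_topology_second_countable: "polish_topology X \<Longrightarrow> second_countable X"
  using metrizable_separable_imp_second_countable polish_topology_metrizable polish_topology_def by blast

section \<open>Regularity of Borel measures\<close>

text \<open>Approximation from both sides at once is a condition that survives complements:
  \<open>C\<close> and \<open>V\<close> swap roles and \<open>V - C\<close> is unchanged. Hence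
  induction over the generated sigma-algebra works. The base case uses that open sets of a
  metrizable space are increasing unions of closed sets.\<close>

lemma finite_borel_measure_approx:
  assumes X: "metrizable_space X" and sM: "sets M = sets (borel_of X)" and "finite_measure M"
    and A: "A \<in> sets M" and "e > 0"
  shows "\<exists>C V. closedin X C \<and> openin X V \<and> C \<subseteq> A \<and> A \<subseteq> V \<and> measure M (V - C) < e"
proof -
  interpret finite_measure M by fact
  have open_M: "openin X V \<Longrightarrow> V \<in> sets M" and closed_M: "closedin X V \<Longrightarrow> V \<in> sets M" for V
    by (simp_all add: sM borel_of_openin borel_of_closedin)
  have "A \<in> sigma_sets (topspace X) {U. openin X U}"
    using A sM sets_borel_of by metis
  then show ?thesis using \<open>e > 0\<close>
  proof (induction A arbitrary: e)
    case (Basic A)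
    then have "openin X A" by simp
    then obtain C where C: "\<And>n. closedin X (C n)" "\<And>n. C n \<subseteq> C (Suc n)" "\<Union>(range C) = A"
      using open_imp_fsigma_in[OF X] unfolding fsigma_in_ascending by metis
    have "(\<lambda>n. measure M (C n)) \<longlonglongrightarrow> measure M (\<Union>n. C n)"
      using C closed_M by (intro finite_Lim_measure_incseq) (auto intro: incseq_SucI)
    then have "\<forall>\<^sub>F n in sequentially. measure M A - e < measure M (C n)"
      using order_tendstoD(1)[of _ "measure M A" sequentially "measure M A - e"] C(3) Basic(2) by simp
    then obtain n where "measure M A - e < measure M (C n)"
      using eventually_sequentially by auto
    moreover have "C n \<subseteq> A" using C by blast
    ultimately have "measure M (A - C n) < e"
      using finite_measure_Diff[OF open_M[OF \<open>openin X A\<close>] closed_M[OF C(1)[of n]]] by simp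
    with C(1) \<open>C n \<subseteq> A\<close> \<open>openin X A\<close> show ?case by blast
  next
    case Empty
    then show ?case by (intro exI[of _ "{}"]) auto
  next
    case (Compl A)
    then obtain C V where CV: "closedin X C" "openin X V" "C \<subseteq> A" "A \<subseteq> V" "measure M (V - C) < e"
      using Compl.IH[OF Compl.prems] by blast
    then have "(topspace X - C) - (topspace X - V) = V - C" using openin_subset by blast
    moreover have "closedin X (topspace X - V)" "openin X (topspace X - C)"
      using CV(1,2) by blast+
    moreover have "topspace X - V \<subseteq> topspace X - A" "topspace X - A \<subseteq> topspace X - C"
      using CV by blast+
    ultimately show ?case using CV(5) by metis
  next
    case (Union A)
    \<comment> \<open>Half of \<open>e\<close> is spread geometrically over the approximations of
      the \<open>A i\<close>. The other half pays for cutting the union of the \<open>C i\<close>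
      down to finitely many, since an infinite union of closed sets need not be closed.\<close>
    have "\<forall>i. \<exists>C V. closedin X C \<and> openin X V \<and> C \<subseteq> A i \<and> A i \<subseteq> V \<and> measure M (V - C) < e / 2 * (1/2)^Suc i"
      using Union.prems by (intro allI Union.IH) simp
    then obtain C V where CV: "\<And>i. closedin X (C i)" "\<And>i. openin X (V i)" "\<And>i. C i \<subseteq> A i" "\<And>i. A i \<subseteq> V i"
      and m: "\<And>i. measure M (V i - C i) < e / 2 * (1/2)^Suc i"
      by metis
    have sV: "V i \<in> sets M" and sC: "C i \<in> sets M" for i using CV open_M closed_M by auto
    have "(\<lambda>n. measure M (\<Union>i\<le>n. C i)) \<longlonglongrightarrow> measure M (\<Union>n. \<Union>i\<le>n. C i)"
      using sC by (intro finite_Lim_measure_incseq incseq_SucI) (auto simp: atMost_Suc)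
    moreover have un: "(\<Union>n. \<Union>i\<le>n. C i) = (\<Union>i. C i)" by auto
    ultimately have "\<forall>\<^sub>F n in sequentially. measure M (\<Union>i. C i) - e / 2 < measure M (\<Union>i\<le>n. C i)"
      using order_tendstoD(1)[of _ "measure M (\<Union>i. C i)" sequentially "measure M (\<Union>i. C i) - e/2"] Union.prems by simp
    then obtain n where n: "measure M (\<Union>i. C i) - e / 2 < measure M (\<Union>i\<le>n. C i)"
      using eventually_sequentially by auto
    have tail: "measure M ((\<Union>i. C i) - (\<Union>i\<le>n. C i)) < e / 2"
      using n finite_measure_Diff[of "\<Union>i. C i" "\<Union>i\<le>n. C i"] sC
      by (subst finite_measure_Diff) auto
    have sums: "(\<lambda>i. e / 2 * (1/2)^Suc i) sums (e / 2)"
      using sums_mult[OF power_half_series, of "e/2"] by simp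
    have summ: "summable (\<lambda>i. measure M (V i - C i))"
      by (rule summable_comparison_test'[OF sums_summable[OF sums], of 0]) (use m less_imp_le in auto)
    have "measure M (\<Union>i. V i - C i) \<le> (\<Sum>i. measure M (V i - C i))"
      using sV sC summ by (intro finite_measure_subadditive_countably) auto
    also have "\<dots> \<le> e / 2"
      using suminf_le[OF _ summ sums_summable[OF sums]] m sums_unique[OF sums] less_imp_le by metis
    finally have "measure M (\<Union>i. V i - C i) \<le> e / 2" .
    moreover have "measure M ((\<Union>i. V i) - (\<Union>i\<le>n. C i))
        \<le> measure M ((\<Union>i. V i - C i) \<union> ((\<Union>i. C i) - (\<Union>i\<le>n. C i)))"
      using sV sC by (intro finite_measure_mono) auto
    moreover have "\<dots> \<le> measure M (\<Union>i. V i - C i) + measure M ((\<Union>i. C i) - (\<Union>i\<le>n. C i))"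
      using sV sC by (intro measure_Un_le) auto
    ultimately have "measure M ((\<Union>i. V i) - (\<Union>i\<le>n. C i)) < e"
      using tail by linarith
    moreover have "closedin X (\<Union>i\<le>n. C i)" "openin X (\<Union>i. V i)"
      using CV(1,2) by (auto intro!: closedin_Union)
    moreover have "(\<Union>i\<le>n. C i) \<subseteq> (\<Union>i. A i)" "(\<Union>i. A i) \<subseteq> (\<Union>i. V i)" using CV(3,4) by blast+
    ultimately show ?case by (intro exI conjI)
  qed
qed

text \<open>The finite case is applied to the restriction of \<open>M\<close> to each
  \<open>W n\<close>. The open set found there is good only inside \<open>W n\<close>, so it is
  intersected with \<open>W n\<close> before the union is taken; the errors are summed
  geometrically.\<close>

lemma sigma_finite_borel_measure_outer_regular:
  assumes X: "metrizable_space X" and sM: "sets M = sets (borel_of X)"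
    and W: "\<And>n. openin X (W n)" "\<And>n::nat. emeasure M (W n) < \<infinity>" "(\<Union>n. W n) = topspace X"
    and A: "A \<in> sets M"
  shows "emeasure M A = (INF U\<in>{U. openin X U \<and> A \<subseteq> U}. emeasure M U)"
proof (rule antisym)
  have open_M: "openin X V \<Longrightarrow> V \<in> sets M" for V
    by (simp add: sM borel_of_openin)
  show "emeasure M A \<le> (INF U\<in>{U. openin X U \<and> A \<subseteq> U}. emeasure M U)"
    by (rule INF_greatest) (auto intro: emeasure_mono open_M)
  show "(INF U\<in>{U. openin X U \<and> A \<subseteq> U}. emeasure M U) \<le> emeasure M A"
  proof (rule ennreal_le_epsilon)
    fix e :: real assume "e > 0"
    define N where "N n = density M (indicator (W n))" for n
    have N: "emeasure (N n) B = emeasure M (W n \<inter> B)" if "B \<in> sets M" for B n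
      using that W(1) open_M by (simp add: N_def emeasure_density flip: indicator_inter_arith)
    have spM: "space M = topspace X" using sets_eq_imp_space_eq[OF sM] by simp
    have fin: "finite_measure (N n)" for n
    proof
      show "emeasure (N n) (space (N n)) \<noteq> \<infinity>"
        using W(2)[of n] openin_subset[OF W(1)[of n]] N[OF sets.top]
        by (simp add: N_def spM Int_absorb2)
    qed
    have "\<exists>V. openin X V \<and> A \<subseteq> V \<and> emeasure M (W n \<inter> V - A) \<le> ennreal (e * (1/2)^Suc n)" for n
    proof -
      interpret finite_measure "N n" by (rule fin)
      obtain C V where CV: "closedin X C" "openin X V" "C \<subseteq> A" "A \<subseteq> V" "measure (N n) (V - C) < e * (1/2)^Suc n"
        using finite_borel_measure_approx[OF X _ fin, of n A "e * (1/2)^Suc n"] A \<open>e > 0\<close> sM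
        by (auto simp: N_def)
      have sC: "C \<in> sets M" "V \<in> sets M" using CV sM borel_of_closedin open_M by auto
      have "emeasure M (W n \<inter> V - A) \<le> emeasure M (W n \<inter> (V - C))"
        using CV sC W(1) open_M by (intro emeasure_mono) auto
      also have "\<dots> = emeasure (N n) (V - C)" using sC by (simp add: N)
      also have "\<dots> \<le> ennreal (e * (1/2)^Suc n)"
        using CV(5) emeasure_eq_measure by (simp add: ennreal_leI)
      finally show ?thesis using CV by blast
    qed
    then obtain V where V: "\<And>n. openin X (V n)" "\<And>n. A \<subseteq> V n"
        "\<And>n. emeasure M (W n \<inter> V n - A) \<le> ennreal (e * (1/2)^Suc n)" by metis
    define U where "U = (\<Union>n. W n \<inter> V n)"
    have "A \<subseteq> topspace X" using sets.sets_into_space[OF A] spM by simp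
    then have AU: "A \<subseteq> U" unfolding U_def using V(2) by (force simp flip: W(3))
    have U: "openin X U" unfolding U_def using V W by blast
    have sums: "(\<lambda>i. e * (1/2)^Suc i) sums e"
      using sums_mult[OF power_half_series, of e] by simp
    have "U - A = (\<Union>n. W n \<inter> V n - A)" unfolding U_def by blast
    then have "emeasure M (U - A) \<le> (\<Sum>n. emeasure M (W n \<inter> V n - A))"
      using V(1) W(1) A open_M by (simp only:) (intro emeasure_subadditive_countably, auto)
    also have "\<dots> \<le> (\<Sum>n. ennreal (e * (1/2)^Suc n))"
      by (intro suminf_le V) auto
    also have "\<dots> = ennreal e"
      using sums \<open>e > 0\<close> by (subst suminf_ennreal2) (auto simp: sums_iff)
    finally have "emeasure M (U - A) \<le> ennreal e" .
    then have "emeasure M U \<le> emeasure M A + ennreal e"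
      using emeasure_subadditive[of A M "U - A"] AU A open_M[OF U]
      by (auto simp: Un_absorb1 intro: order_trans add_left_mono)
    then show "(INF U\<in>{U. openin X U \<and> A \<subseteq> U}. emeasure M U) \<le> emeasure M A + ennreal e"
      using U AU by (intro INF_lower2[of U]) auto
  qed
qed

text \<open>Finiteness on compact sets implies both regularity conditions here. The space is covered
  by countably many open sets with compact hulls \<open>K n\<close>, which gives sigma-finiteness by
  open sets and thus outer regularity. For inner regularity an open set is exhausted by closed sets
  \<open>C n\<close>, cut down to the compact sets \<open>L n\<close> by the first
  \<open>K i\<close>.\<close>

lemma radon_measureI:
  assumes X: "metrizable_space X" "second_countable X" "locally_compact_space X"
    and sM: "sets M = sets (borel_of X)"
    and fin: "\<And>K. compactin X K \<Longrightarrow> emeasure M K < \<infinity>"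
  shows "radon_measure X M"
proof -
  have open_M: "openin X V \<Longrightarrow> V \<in> sets M" and closed_M: "closedin X V \<Longrightarrow> V \<in> sets M" for V
    by (simp_all add: sM borel_of_openin borel_of_closedin)
  have spM: "space M = topspace X" using sets_eq_imp_space_eq[OF sM] by simp
  have haus: "Hausdorff_space X" using X by (simp add: metrizable_imp_Hausdorff_space)
  let ?P = "\<lambda>U. \<exists>K. compactin X K \<and> U \<subseteq> K"
  have cover: "\<exists>U. openin X U \<and> x \<in> U \<and> ?P U" if "x \<in> topspace X" for x
    using X(3) that unfolding locally_compact_space_def by blast
  have mono: "?P V" if "openin X U" "openin X V" "V \<subseteq> U" "?P U" for U V
    using that by (meson order_trans)
  have empty: "?P {}" using compactin_empty by blast
  obtain W :: "nat \<Rightarrow> 'a set" where W: "\<And>n. openin X (W n)" "\<And>n. ?P (W n)"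
    and base: "\<And>U x. openin X U \<Longrightarrow> x \<in> U \<Longrightarrow> \<exists>n. x \<in> W n \<and> W n \<subseteq> U"
  proof (rule second_countable_Int_stable_base[OF X(2), where P = ?P])
    fix W :: "nat \<Rightarrow> 'a set"
    assume "\<And>n. openin X (W n)" "\<And>n. ?P (W n)" "\<And>U x. openin X U \<Longrightarrow> x \<in> U \<Longrightarrow> \<exists>n. x \<in> W n \<and> W n \<subseteq> U"
    then show thesis by (rule that)
  next
    show "\<exists>U. openin X U \<and> x \<in> U \<and> ?P U" if "x \<in> topspace X" for x using that by (rule cover)
    show "?P V" if "openin X U" "openin X V" "V \<subseteq> U" "?P U" for U V using that by (rule mono)
    show "?P {}" by (rule empty)
  qed
  have W_cover: "(\<Union>n. W n) = topspace X"
  proof (rule antisym)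
    show "(\<Union>n. W n) \<subseteq> topspace X" by (intro UN_least openin_subset W(1))
    show "topspace X \<subseteq> (\<Union>n. W n)"
    proof
      fix x assume "x \<in> topspace X"
      from base[OF openin_topspace this] show "x \<in> (\<Union>n. W n)" by auto
    qed
  qed
  from W(2) obtain K :: "nat \<Rightarrow> 'a set" where K: "\<And>n. compactin X (K n)" "\<And>n. W n \<subseteq> K n" by metis
  have inner: "emeasure M U = (SUP K\<in>{K. compactin X K \<and> K \<subseteq> U}. emeasure M K)" if U: "openin X U" for U
  proof (rule antisym)
    obtain C where C: "\<And>n. closedin X (C n)" "\<And>n. C n \<subseteq> C (Suc n)" "\<Union>(range C) = U"
      using open_imp_fsigma_in[OF X(1) U] unfolding fsigma_in_ascending by metis
    define L where "L n = C n \<inter> (\<Union>i\<le>n. K i)" for n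
    have L: "compactin X (L n)" for n
      unfolding L_def by (intro closed_Int_compactin C compactin_Union) (use K in auto)
    have "incseq L"
      unfolding L_def using C(2) by (intro incseq_SucI) (auto simp: atMost_Suc)
    have sL: "L n \<in> sets M" for n
      by (intro closed_M compactin_imp_closedin[OF haus L])
    have mC: "C i \<subseteq> C j" if "i \<le> j" for i j
      using lift_Suc_mono_le[of C i j, OF C(2) that] .
    have "x \<in> (\<Union>n. L n)" if xU: "x \<in> U" for x
    proof -
      obtain i where "x \<in> C i" using xU C(3) by blast
      moreover obtain j where "x \<in> K j"
        using xU openin_subset[OF U] K(2) unfolding W_cover[symmetric] by blast
      ultimately have "x \<in> L (max i j)" unfolding L_def using mC[of i "max i j"] by auto
      then show ?thesis by blast
    qed
    moreover have LU: "L n \<subseteq> U" for n using C(3) by (auto simp: L_def)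
    ultimately have "(\<Union>n. L n) = U" by blast
    then have "emeasure M U = (SUP n. emeasure M (L n))"
      using SUP_emeasure_incseq[OF _ \<open>incseq L\<close>, of M] sL by (simp add: image_subset_iff)
    also have "\<dots> \<le> (SUP K\<in>{K. compactin X K \<and> K \<subseteq> U}. emeasure M K)"
      using L LU by (intro SUP_mono) auto
    finally show "emeasure M U \<le> (SUP K\<in>{K. compactin X K \<and> K \<subseteq> U}. emeasure M K)" .
    show "(SUP K\<in>{K. compactin X K \<and> K \<subseteq> U}. emeasure M K) \<le> emeasure M U"
      using U open_M by (intro SUP_least emeasure_mono) auto
  qed
  have "emeasure M (W n) < \<infinity>" for n
  proof (rule order_le_less_trans)
    show "emeasure M (W n) \<le> emeasure M (K n)"
      by (intro emeasure_mono K closed_M compactin_imp_closedin[OF haus])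
    show "emeasure M (K n) < \<infinity>" by (intro fin K)
  qed
  note outer = sigma_finite_borel_measure_outer_regular[OF X(1) sM W(1) this W_cover]
  show ?thesis
    unfolding radon_measure_def by (intro conjI allI impI ballI haus spM sM fin inner outer)
qed

section \<open>Borel measures from contents on compact sets\<close>

text \<open>\<open>c\<close> carries information on compact sets only. This and
  \<open>outer_content\<close> are the two stages of the classical extension of a content: to open
  sets from inside, then to all sets from outside.\<close>

definition inner_content :: "'a topology \<Rightarrow> ('a set \<Rightarrow> ennreal) \<Rightarrow> 'a set \<Rightarrow> ennreal" where
  "inner_content X c U = (SUP K\<in>{K. compactin X K \<and> K \<subseteq> U}. c K)"

definition outer_content :: "'a topology \<Rightarrow> ('a set \<Rightarrow> ennreal) \<Rightarrow> 'a set \<Rightarrow> ennreal" where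
  "outer_content X c A = (INF U\<in>{U. openin X U \<and> A \<subseteq> U}. inner_content X c U)"

lemma inner_content_upper: "compactin X K \<Longrightarrow> K \<subseteq> U \<Longrightarrow> c K \<le> inner_content X c U"
  unfolding inner_content_def by (rule SUP_upper) simp

lemma inner_content_mono: "U \<subseteq> V \<Longrightarrow> inner_content X c U \<le> inner_content X c V"
  unfolding inner_content_def by (rule SUP_subset_mono) auto

lemma outer_content_lower: "openin X U \<Longrightarrow> A \<subseteq> U \<Longrightarrow> outer_content X c A \<le> inner_content X c U"
  unfolding outer_content_def by (rule INF_lower) simp

lemma outer_content_mono: "A \<subseteq> B \<Longrightarrow> outer_content X c A \<le> outer_content X c B"
  unfolding outer_content_def by (rule INF_superset_mono) auto

lemma outer_content_openin: "openin X U \<Longrightarrow> outer_content X c U = inner_content X c U"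
  by (intro antisym outer_content_lower order_refl)
    (auto simp: outer_content_def intro!: INF_greatest inner_content_mono)

text \<open>\<open>K - U\<close> and \<open>K - V\<close> are disjoint compact sets; disjoint open
  neighbourhoods of them are cut out of \<open>K\<close>. This splitting carries subadditivity from
  compact sets to open sets.\<close>

lemma Hausdorff_compactin_Un_decompose:
  assumes X: "Hausdorff_space X" and K: "compactin X K"
    and U: "openin X U" "openin X V" "K \<subseteq> U \<union> V"
  obtains L M where "compactin X L" "compactin X M" "L \<subseteq> U" "M \<subseteq> V" "K = L \<union> M"
proof -
  have diff: "compactin X (K - W)" if "openin X W" for W
  proof -
    have "K - W = K \<inter> (topspace X - W)" using compactin_subset_topspace[OF K] by blast
    with that show ?thesis
      using closed_Int_compactin[OF closedin_diff[OF closedin_topspace that] K] by (simp add: Int_commute)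
  qed
  have "disjnt (K - U) (K - V)" using U(3) by (auto simp: disjnt_def)
  then obtain A B where AB: "openin X A" "openin X B" "K - U \<subseteq> A" "K - V \<subseteq> B" "disjnt A B"
    using Hausdorff_space_compact_separation[OF X diff[OF U(1)] diff[OF U(2)]] by metis
  show ?thesis
  proof
    show "compactin X (K - A)" "compactin X (K - B)" using diff AB(1,2) by auto
    show "K - A \<subseteq> U" "K - B \<subseteq> V" "K = (K - A) \<union> (K - B)"
      using AB(3-5) by (auto simp: disjnt_iff)
  qed
qed

locale compact_content =
  fixes X :: "'a topology" and c :: "'a set \<Rightarrow> ennreal"
  assumes Hausdorff: "Hausdorff_space X"
    and empty: "c {} = 0"
    and mono: "\<And>K L. compactin X K \<Longrightarrow> compactin X L \<Longrightarrow> K \<subseteq> L \<Longrightarrow> c K \<le> c L"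
    and subadditive: "\<And>K L. compactin X K \<Longrightarrow> compactin X L \<Longrightarrow> c (K \<union> L) \<le> c K + c L"
    and additive: "\<And>K L. compactin X K \<Longrightarrow> compactin X L \<Longrightarrow> K \<inter> L = {} \<Longrightarrow> c (K \<union> L) = c K + c L"
begin

lemma content_le_sum:
  assumes "\<And>i::nat. openin X (U i)"
  shows "compactin X K \<Longrightarrow> K \<subseteq> (\<Union>i<n. U i) \<Longrightarrow> c K \<le> (\<Sum>i<n. inner_content X c (U i))"
proof (induction n arbitrary: K)
  case 0
  then show ?case by (simp add: empty)
next
  case (Suc n)
  have "K \<subseteq> (\<Union>i<n. U i) \<union> U n" using Suc.prems(2) by (auto simp: lessThan_Suc)
  moreover have "openin X (\<Union>i<n. U i)" using assms by auto
  ultimately obtain L M where LM: "compactin X L" "compactin X M" "L \<subseteq> (\<Union>i<n. U i)" "M \<subseteq> U n" "K = L \<union> M"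
    using Hausdorff_compactin_Un_decompose[OF Hausdorff Suc.prems(1) _ assms[of n]] by metis
  have "c K \<le> c L + c M" using LM subadditive by simp
  also have "\<dots> \<le> (\<Sum>i<n. inner_content X c (U i)) + inner_content X c (U n)"
    using LM by (intro add_mono Suc.IH inner_content_upper)
  finally show ?case by simp
qed

text \<open>A compact subset of the union already lies in finitely many of the sets, which leaves
  the finite case.\<close>

lemma inner_content_countably_subadditive:
  assumes U: "\<And>i::nat. openin X (U i)"
  shows "inner_content X c (\<Union>i. U i) \<le> (\<Sum>i. inner_content X c (U i))"
  unfolding inner_content_def[of X c "\<Union>i. U i"]
proof (rule SUP_least, clarsimp)
  fix K assume K: "compactin X K" "K \<subseteq> (\<Union>i. U i)"
  then obtain \<F> where \<F>: "finite \<F>" "\<F> \<subseteq> range U" "K \<subseteq> \<Union>\<F>"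
    using U compactinD[OF K(1), of "range U"] by auto
  then obtain I where I: "finite I" "\<F> = U ` I" using finite_subset_image[of \<F> U UNIV] by auto
  then obtain n where n: "I \<subseteq> {..<n}" using finite_nat_bounded by blast
  have "c K \<le> (\<Sum>i<n. inner_content X c (U i))"
    using \<F>(3) I n by (intro content_le_sum U K) auto
  also have "\<dots> \<le> (\<Sum>i. inner_content X c (U i))" by (rule sum_le_suminf) auto
  finally show "c K \<le> (\<Sum>i. inner_content X c (U i))" .
qed

lemma outer_content_countably_subadditive:
  "outer_content X c (\<Union>i. A i) \<le> (\<Sum>i::nat. outer_content X c (A i))"
proof (rule ennreal_le_epsilon)
  fix e :: real assume e: "e > 0" and fin: "(\<Sum>i. outer_content X c (A i)) < Orderings.top"
  have "\<exists>U. openin X U \<and> A i \<subseteq> U \<and> inner_content X c U \<le> outer_content X c (A i) + ennreal (e * (1/2)^Suc i)" for i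
  proof -
    \<comment> \<open>Finiteness of the sum makes each term finite, hence strictly smaller than
      itself plus a positive error; a strict inequality is what yields a member of the
      infimum.\<close>
    have "outer_content X c (A i) < outer_content X c (A i) + ennreal (e * (1/2)^Suc i)"
      using ennreal_suminf_lessD[OF fin, of i] e
        ennreal_add_left_cancel_less[of "outer_content X c (A i)" 0 "ennreal (e * (1/2)^Suc i)"]
      by simp
    then show ?thesis unfolding outer_content_def[of X c "A i"] INF_less_iff by (auto intro: less_imp_le)
  qed
  then obtain U where U: "\<And>i. openin X (U i)" "\<And>i. A i \<subseteq> U i"
     "\<And>i. inner_content X c (U i) \<le> outer_content X c (A i) + ennreal (e * (1/2)^Suc i)" by metis
  have sums: "(\<lambda>i. e * (1/2)^Suc i) sums e"
    using sums_mult[OF power_half_series, of e] by simp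
  have "outer_content X c (\<Union>i. A i) \<le> inner_content X c (\<Union>i. U i)"
    using U by (intro outer_content_lower) auto
  also have "\<dots> \<le> (\<Sum>i. inner_content X c (U i))"
    by (rule inner_content_countably_subadditive[OF U(1)])
  also have "\<dots> \<le> (\<Sum>i. outer_content X c (A i) + ennreal (e * (1/2)^Suc i))"
    by (intro suminf_le U) auto
  also have "\<dots> = (\<Sum>i. outer_content X c (A i)) + (\<Sum>i. ennreal (e * (1/2)^Suc i))"
    by (intro suminf_add[symmetric]) auto
  also have "(\<Sum>i. ennreal (e * (1/2)^Suc i)) = ennreal e"
    using sums e by (subst suminf_ennreal2) (auto simp: sums_iff)
  finally show "outer_content X c (\<Union>i. A i) \<le> (\<Sum>i. outer_content X c (A i)) + ennreal e" .
qed

lemma outer_content_empty: "outer_content X c {} = 0"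
  by (simp add: outer_content_openin inner_content_def empty)

lemma outer_content_Un: "outer_content X c (A \<union> B) \<le> outer_content X c A + outer_content X c B"
proof -
  have "outer_content X c (\<Union>i. binaryset A B i) \<le> (\<Sum>i. outer_content X c (binaryset A B i))"
    by (rule outer_content_countably_subadditive)
  also have "\<dots> = outer_content X c A + outer_content X c B"
    by (rule suminf_binaryset_eq) (rule outer_content_empty)
  finally show ?thesis by (simp add: UN_binaryset_eq)
qed

text \<open>This is where additivity on disjoint compact sets enters. For a compact \<open>C\<close>
  inside \<open>U \<inter> V\<close>, the set \<open>V - U\<close> lies in the open set
  \<open>V - C\<close>, and every compact \<open>D\<close> in there is disjoint from
  \<open>C\<close>, so \<open>c C + c D\<close> is the content of a compact subset of
  \<open>V\<close>.\<close>

lemma inner_content_split: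
  assumes U: "openin X U" and V: "openin X V"
  shows "inner_content X c (U \<inter> V) + outer_content X c (V - U) \<le> inner_content X c V"
proof -
  let ?I = "{C. compactin X C \<and> C \<subseteq> U \<inter> V}"
  have ne: "?I \<noteq> {}" by auto
  have "c C + outer_content X c (V - U) \<le> inner_content X c V" if C: "compactin X C" "C \<subseteq> U \<inter> V" for C
  proof -
    have opn: "openin X (V - C)" using V compactin_imp_closedin[OF Hausdorff C(1)] by blast
    let ?J = "{D. compactin X D \<and> D \<subseteq> V - C}"
    have "c C + outer_content X c (V - U) \<le> c C + inner_content X c (V - C)"
      using C(2) by (intro add_left_mono outer_content_lower opn) auto
    also have "\<dots> = (SUP D\<in>?J. c C + c D)"
      unfolding inner_content_def by (intro ennreal_SUP_add_right) auto
    also have "\<dots> \<le> inner_content X c V"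
    proof (rule SUP_least)
      fix D assume D: "D \<in> ?J"
      then have "c C + c D = c (C \<union> D)" using C by (intro additive[symmetric]) auto
      also have "\<dots> \<le> inner_content X c V"
        using C D by (intro inner_content_upper compactin_Un) auto
      finally show "c C + c D \<le> inner_content X c V" .
    qed
    finally show ?thesis .
  qed
  then show ?thesis
    unfolding inner_content_def[of X c "U \<inter> V"]
    by (subst ennreal_SUP_add_left[OF ne, symmetric]) (auto intro!: SUP_least)
qed

text \<open>In Caratheodory's condition an arbitrary test set may be replaced by the open sets
  containing it, which reduces the nontrivial inequality to
  \<open>inner_content_split\<close>.\<close>

lemma openin_lambda_system:
  assumes U: "openin X U"
  shows "U \<in> lambda_system (topspace X) (Pow (topspace X)) (outer_content X c)"
  unfolding lambda_system_def
proof (intro CollectI conjI ballI antisym)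
  show "U \<in> Pow (topspace X)" using openin_subset[OF U] by simp
  fix A assume A: "A \<in> Pow (topspace X)"
  have "A = U \<inter> A \<union> (topspace X - U) \<inter> A" using A by blast
  then show "outer_content X c A \<le> outer_content X c (U \<inter> A) + outer_content X c ((topspace X - U) \<inter> A)"
    using outer_content_Un by metis
  show "outer_content X c (U \<inter> A) + outer_content X c ((topspace X - U) \<inter> A) \<le> outer_content X c A"
    unfolding outer_content_def[of X c A]
  proof (rule INF_greatest, clarsimp)
    fix V assume V: "openin X V" "A \<subseteq> V"
    have "outer_content X c (U \<inter> A) + outer_content X c ((topspace X - U) \<inter> A)
        \<le> inner_content X c (U \<inter> V) + outer_content X c (V - U)"
      using V U by (intro add_mono outer_content_lower outer_content_mono) auto
    also have "\<dots> \<le> inner_content X c V" by (rule inner_content_split[OF U V(1)])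
    finally show "outer_content X c (U \<inter> A) + outer_content X c ((topspace X - U) \<inter> A) \<le> inner_content X c V" .
  qed
qed

lemma measure_exists:
  obtains M where "sets M = sets (borel_of X)" "\<And>A. A \<in> sets M \<Longrightarrow> emeasure M A = outer_content X c A"
proof -
  let ?L = "lambda_system (topspace X) (Pow (topspace X)) (outer_content X c)"
  let ?B = "sets (borel_of X)"
  have "outer_measure_space (Pow (topspace X)) (outer_content X c)"
    unfolding outer_measure_space_def positive_def increasing_def countably_subadditive_def
    using outer_content_empty outer_content_mono outer_content_countably_subadditive by auto
  then have L: "measure_space (topspace X) ?L (outer_content X c)"
    by (rule sigma_algebra.caratheodory_lemma[OF sigma_algebra_Pow])
  then interpret L: sigma_algebra "topspace X" ?L by (simp add: measure_space_def)
  have BL: "?B \<subseteq> ?L"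
    unfolding sets_borel_of by (rule L.sigma_sets_subset) (auto intro: openin_lambda_system)
  have "countably_additive ?L (outer_content X c)" using L by (simp add: measure_space_def)
  with BL have ca: "countably_additive ?B (outer_content X c)"
    unfolding countably_additive_def by blast
  have sa: "sigma_algebra (topspace X) ?B"
    using sets.sigma_algebra_axioms[of "borel_of X"] by simp
  show ?thesis
  proof
    show sets: "sets (measure_of (topspace X) ?B (outer_content X c)) = ?B"
      by (rule sigma_algebra.sets_measure_of_eq[OF sa])
    show "emeasure (measure_of (topspace X) ?B (outer_content X c)) A = outer_content X c A"
      if "A \<in> sets (measure_of (topspace X) ?B (outer_content X c))" for A
      using that ca unfolding sets
      by (intro emeasure_measure_of_sigma[OF sa]) (auto simp: positive_def outer_content_empty)
  qed
qed

end

section \<open>Right Haar measure\<close>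

locale lc_group =
  fixes G (structure) and T
  assumes topological_group: "topological_group G T"
    and Hausdorff: "Hausdorff_space T"
    and locally_compact: "locally_compact_space T"

sublocale lc_group \<subseteq> group G
  using topological_group by (simp add: topological_group_def)

context lc_group
begin

lemma topspace_eq [simp]: "topspace T = carrier G"
  using topological_group by (simp add: topological_group_def)

lemma continuous_mult: "continuous_map (prod_topology T T) T (\<lambda>(g, h). g \<otimes> h)"
  and continuous_inv: "continuous_map T T (\<lambda>g. inv g)"
  using topological_group by (simp_all add: topological_group_def)

lemma continuous_right_translation:
  assumes "g \<in> carrier G"
  shows "continuous_map T T (\<lambda>x. x \<otimes> g)"
proof -
  have "continuous_map T (prod_topology T T) (\<lambda>x. (x, g))"
    using assms by (simp add: continuous_map_pairedI)
  from continuous_map_compose[OF this continuous_mult] show ?thesis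
    by (simp add: o_def)
qed

text \<open>\<open>#>\<close> is used for right translates of arbitrary subsets, not only of
  subgroups.\<close>

lemma r_coset_eq_image: "A #> g = (\<lambda>x. x \<otimes> g) ` A"
  by (auto simp: r_coset_def)

lemma r_coset_cancel: "A \<subseteq> carrier G \<Longrightarrow> g \<in> carrier G \<Longrightarrow> (A #> g) #> inv g = A"
  by (simp add: coset_mult_assoc coset_mult_one)

lemma r_coset_eq_vimage:
  assumes "A \<subseteq> carrier G" "g \<in> carrier G"
  shows "A #> g = {x \<in> carrier G. x \<otimes> inv g \<in> A}"
proof (intro subset_antisym subsetI)
  fix x assume x: "x \<in> {x \<in> carrier G. x \<otimes> inv g \<in> A}"
  then have "(x \<otimes> inv g) \<otimes> g = x" using assms by (simp add: m_assoc)
  with x show "x \<in> A #> g" unfolding r_coset_eq_image by (metis (mono_tags, lifting) image_eqI mem_Collect_eq)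
next
  fix x assume "x \<in> A #> g"
  then obtain a where a: "a \<in> A" "x = a \<otimes> g" by (auto simp: r_coset_eq_image)
  then have "x \<otimes> inv g = a" using assms by (simp add: m_assoc subsetD)
  with a assms show "x \<in> {x \<in> carrier G. x \<otimes> inv g \<in> A}" by auto
qed

lemma compactin_r_coset: "compactin T K \<Longrightarrow> g \<in> carrier G \<Longrightarrow> compactin T (K #> g)"
  unfolding r_coset_eq_image by (rule image_compactin[OF _ continuous_right_translation])

lemma openin_r_coset:
  assumes "openin T U" "g \<in> carrier G"
  shows "openin T (U #> g)"
  using openin_continuous_map_preimage[OF continuous_right_translation[of "inv g"] assms(1)]
    assms openin_subset[OF assms(1)] by (simp add: r_coset_eq_vimage)

lemma borel_r_coset:
  assumes "A \<in> sets (borel_of T)" "g \<in> carrier G"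
  shows "A #> g \<in> sets (borel_of T)"
proof -
  have "A \<subseteq> carrier G" using sets.sets_into_space[OF assms(1)] by simp
  moreover have "(\<lambda>x. x \<otimes> inv g) -` A \<inter> space (borel_of T) \<in> sets (borel_of T)"
    using assms continuous_right_translation[of "inv g"]
    by (intro measurable_sets[OF continuous_map_borel_measurable]) auto
  ultimately show ?thesis
    using assms(2) by (auto simp: r_coset_eq_vimage vimage_def Int_def conj_commute)
qed

section \<open>Covering numbers by right translates\<close>

definition covers :: "'a set \<Rightarrow> 'a set \<Rightarrow> 'a set \<Rightarrow> bool" where
  "covers V K S \<longleftrightarrow> finite S \<and> S \<subseteq> carrier G \<and> K \<subseteq> (\<Union>s\<in>S. V #> s)"

text \<open>Haar's index \<open>(K : V)\<close>. Covering by right translates makes it invariant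
  under right translation of \<open>K\<close>.\<close>

definition covering_number :: "'a set \<Rightarrow> 'a set \<Rightarrow> nat" where
  "covering_number V K = (LEAST n. \<exists>S. covers V K S \<and> card S = n)"

lemma covers_exists:
  assumes V: "openin T V" "V \<noteq> {}" and K: "compactin T K"
  shows "\<exists>S. covers V K S"
proof -
  obtain v where v: "v \<in> V" "v \<in> carrier G" using V openin_subset by fastforce
  have "K \<subseteq> (\<Union>s\<in>carrier G. V #> s)"
  proof
    fix x assume "x \<in> K"
    then have x: "x \<in> carrier G" using compactin_subset_topspace[OF K] by auto
    then have "x = v \<otimes> (inv v \<otimes> x)" using v by (simp add: m_assoc[symmetric])
    then show "x \<in> (\<Union>s\<in>carrier G. V #> s)"
      using v x unfolding r_coset_eq_image by (metis UN_iff image_eqI inv_closed m_closed)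
  qed
  then obtain \<F> where \<F>: "finite \<F>" "\<F> \<subseteq> (\<lambda>s. V #> s) ` carrier G" "K \<subseteq> \<Union>\<F>"
    using compactinD[OF K, of "(\<lambda>s. V #> s) ` carrier G"] openin_r_coset[OF V(1)] by auto
  then obtain S where "finite S" "S \<subseteq> carrier G" "\<F> = (\<lambda>s. V #> s) ` S"
    using finite_subset_image by metis
  with \<F>(3) show ?thesis unfolding covers_def by auto
qed

lemma covering_number_le: "covers V K S \<Longrightarrow> covering_number V K \<le> card S"
  unfolding covering_number_def by (rule Least_le) auto

lemma covering_number_attained:
  assumes "openin T V" "V \<noteq> {}" "compactin T K"
  obtains S where "covers V K S" "card S = covering_number V K"
proof -
  have "\<exists>n S. covers V K S \<and> card S = n" using covers_exists[OF assms] by auto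
  from LeastI_ex[OF this] show ?thesis using that unfolding covering_number_def by auto
qed

lemma covering_number_mono:
  assumes "openin T V" "V \<noteq> {}" "compactin T L" "K \<subseteq> L"
  shows "covering_number V K \<le> covering_number V L"
proof -
  obtain S where S: "covers V L S" "card S = covering_number V L"
    using covering_number_attained[OF assms(1-3)] .
  then have "covers V K S" using assms(4) unfolding covers_def by blast
  with S show ?thesis using covering_number_le by metis
qed

lemma covering_number_Un:
  assumes V: "openin T V" "V \<noteq> {}" and "compactin T K" "compactin T L"
  shows "covering_number V (K \<union> L) \<le> covering_number V K + covering_number V L"
proof -
  obtain S where S: "covers V K S" "card S = covering_number V K"
    using covering_number_attained[OF V assms(3)] .
  obtain S' where S': "covers V L S'" "card S' = covering_number V L"
    using covering_number_attained[OF V assms(4)] .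
  have "covers V (K \<union> L) (S \<union> S')" using S S' unfolding covers_def by blast
  then show ?thesis using S(2) S'(2) covering_number_le card_Un_le le_trans by metis
qed

lemma covering_number_r_coset_le:
  assumes V: "openin T V" "V \<noteq> {}" and K: "compactin T K" and g: "g \<in> carrier G"
  shows "covering_number V (K #> g) \<le> covering_number V K"
proof -
  obtain S where S: "covers V K S" "card S = covering_number V K"
    using covering_number_attained[OF V K] .
  have VG: "V \<subseteq> carrier G" using openin_subset[OF V(1)] by simp
  have "covers V (K #> g) ((\<lambda>s. s \<otimes> g) ` S)"
    unfolding covers_def
  proof (intro conjI subsetI)
    fix y assume "y \<in> K #> g"
    then obtain x where x: "x \<in> K" "y = x \<otimes> g" by (auto simp: r_coset_eq_image)
    then obtain s v where s: "s \<in> S" "v \<in> V" "x = v \<otimes> s"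
      using S(1) unfolding covers_def r_coset_eq_image by blast
    then have "y = v \<otimes> (s \<otimes> g)" using x g VG S(1) unfolding covers_def by (auto simp: m_assoc subset_iff)
    then show "y \<in> (\<Union>s\<in>(\<lambda>s. s \<otimes> g) ` S. V #> s)" using s by (auto simp: r_coset_eq_image)
  qed (use S(1) g in \<open>auto simp: covers_def\<close>)
  from covering_number_le[OF this] S(2) show ?thesis
    using card_image_le[of S "\<lambda>s. s \<otimes> g"] S(1) by (auto simp: covers_def)
qed

lemma covering_number_r_coset:
  assumes V: "openin T V" "V \<noteq> {}" and K: "compactin T K" and g: "g \<in> carrier G"
  shows "covering_number V (K #> g) = covering_number V K"
  using covering_number_r_coset_le[OF V K g] compactin_subset_topspace[OF K] g
    covering_number_r_coset_le[OF V compactin_r_coset[OF K g] inv_closed[OF g]]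
  by (simp add: r_coset_cancel)

text \<open>Covers compose: \<open>K\<close> by translates of \<open>W\<close>, and \<open>W\<close>
  by translates of \<open>V\<close>. With a fixed \<open>L\<close> this bounds the quotient of the
  indices of \<open>K\<close> and \<open>L\<close> by the index of \<open>K\<close> relative to
  \<open>W\<close>, which does not depend on \<open>V\<close>; so the normalized indices stay in a
  fixed compact product.\<close>

lemma covering_number_le_mult:
  assumes V: "openin T V" "V \<noteq> {}" and W: "openin T W" "W \<noteq> {}" "W \<subseteq> L"
    and K: "compactin T K" and L: "compactin T L"
  shows "covering_number V K \<le> covering_number W K * covering_number V L"
proof -
  obtain S where S: "covers W K S" "card S = covering_number W K"
    using covering_number_attained[OF W(1,2) K] .
  obtain R where R: "covers V L R" "card R = covering_number V L"
    using covering_number_attained[OF V L] .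
  have VG: "V \<subseteq> carrier G" using openin_subset[OF V(1)] by simp
  have "covers V K ((\<lambda>(s, r). r \<otimes> s) ` (S \<times> R))"
    unfolding covers_def
  proof (intro conjI subsetI)
    fix x assume "x \<in> K"
    then obtain s w where s: "s \<in> S" "w \<in> W" "x = w \<otimes> s"
      using S(1) unfolding covers_def r_coset_eq_image by blast
    with W(3) obtain r v where r: "r \<in> R" "v \<in> V" "w = v \<otimes> r"
      using R(1) unfolding covers_def r_coset_eq_image by blast
    have "x = v \<otimes> (r \<otimes> s)" using s r VG S(1) R(1) unfolding covers_def by (auto simp: m_assoc subset_iff)
    then show "x \<in> (\<Union>s\<in>(\<lambda>(s, r). r \<otimes> s) ` (S \<times> R). V #> s)"
      using s(1) r(1,2) by (force simp: r_coset_eq_image)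
  qed (use S(1) R(1) in \<open>auto simp: covers_def\<close>)
  from covering_number_le[OF this] show ?thesis
    using card_image_le[of "S \<times> R" "\<lambda>(s, r). r \<otimes> s"] S R
    by (auto simp: covers_def card_cartesian_product)
qed

lemma covering_number_pos:
  assumes "openin T V" "V \<noteq> {}" "compactin T K" "K \<noteq> {}"
  shows "covering_number V K > 0"
proof -
  obtain S where S: "covers V K S" "card S = covering_number V K"
    using covering_number_attained[OF assms(1-3)] .
  with assms(4) have "S \<noteq> {}" "finite S" by (auto simp: covers_def)
  with S(2) show ?thesis using card_gt_0_iff by metis
qed

text \<open>If no translate meets both sets, an optimal cover of the union contains two disjoint
  subfamilies, one covering \<open>K\<close> and one covering \<open>L\<close>.\<close>

lemma covering_number_Un_separated:
  assumes V: "openin T V" "V \<noteq> {}" and K: "compactin T K" and L: "compactin T L"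
    and sep: "\<And>s. s \<in> carrier G \<Longrightarrow> (V #> s) \<inter> K = {} \<or> (V #> s) \<inter> L = {}"
  shows "covering_number V (K \<union> L) = covering_number V K + covering_number V L"
proof (rule antisym)
  show "covering_number V (K \<union> L) \<le> covering_number V K + covering_number V L"
    by (rule covering_number_Un[OF V K L])
  obtain S where S: "covers V (K \<union> L) S" "card S = covering_number V (K \<union> L)"
    using covering_number_attained[OF V compactin_Un[OF K L]] .
  define A where "A = {s \<in> S. (V #> s) \<inter> K \<noteq> {}}"
  define B where "B = {s \<in> S. (V #> s) \<inter> L \<noteq> {}}"
  have fin: "finite S" "S \<subseteq> carrier G" using S(1) by (auto simp: covers_def)
  have "K \<subseteq> (\<Union>s\<in>A. V #> s)" "L \<subseteq> (\<Union>s\<in>B. V #> s)"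
    using S(1) unfolding covers_def A_def B_def by blast+
  then have "covers V K A" "covers V L B"
    using fin by (auto simp: covers_def A_def B_def)
  then have "covering_number V K + covering_number V L \<le> card A + card B"
    by (intro add_mono covering_number_le)
  also have "\<dots> = card (A \<union> B)"
    using sep fin by (intro card_Un_disjoint[symmetric]) (auto simp: A_def B_def)
  also have "\<dots> \<le> card S" using fin by (intro card_mono) (auto simp: A_def B_def)
  finally show "covering_number V K + covering_number V L \<le> covering_number V (K \<union> L)"
    using S(2) by simp
qed

text \<open>The quotients \<open>k \<otimes> inv l\<close> form a compact set \<open>D\<close> that
  misses the identity, so quotients of elements of a small \<open>V0\<close> avoid \<open>D\<close>.
  A translate meeting both sets, in \<open>v \<otimes> s\<close> and \<open>w \<otimes> s\<close>,
  would put \<open>v \<otimes> inv w\<close> into \<open>D\<close>.\<close>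

lemma compactin_disjoint_separated:
  assumes K: "compactin T K" and L: "compactin T L" and disj: "K \<inter> L = {}"
  obtains V0 where "openin T V0" "\<one> \<in> V0"
    "\<And>V s. V \<subseteq> V0 \<Longrightarrow> s \<in> carrier G \<Longrightarrow> (V #> s) \<inter> K = {} \<or> (V #> s) \<inter> L = {}"
proof -
  have div: "continuous_map (prod_topology T T) T (\<lambda>(g, h). g \<otimes> inv h)"
  proof -
    have "continuous_map (prod_topology T T) (prod_topology T T) (\<lambda>p. (fst p, inv (snd p)))"
      by (intro continuous_map_pairedI continuous_map_fst
          continuous_map_compose[OF continuous_map_snd continuous_inv, unfolded o_def])
    from continuous_map_compose[OF this continuous_mult] show ?thesis
      by (simp add: o_def case_prod_unfold)
  qed
  have KG: "K \<subseteq> carrier G" "L \<subseteq> carrier G" using compactin_subset_topspace[OF K] compactin_subset_topspace[OF L] by simp_all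
  define D where "D = (\<lambda>(g, h). g \<otimes> inv h) ` (K \<times> L)"
  have "compactin T D" unfolding D_def
    by (rule image_compactin[OF _ div]) (simp add: compactin_Times K L)
  then have D: "openin T (carrier G - D)"
    using compactin_imp_closedin[OF Hausdorff] by (metis openin_diff openin_topspace topspace_eq)
  have "\<one> \<notin> D"
  proof
    assume "\<one> \<in> D"
    then obtain k l where kl: "k \<in> K" "l \<in> L" "k \<otimes> inv l = \<one>" by (auto simp: D_def)
    then have "k = l" using KG inv_equality[of k "inv l"] by (auto simp: subset_iff)
    with kl disj show False by blast
  qed
  define W where "W = {p \<in> topspace (prod_topology T T). (\<lambda>(g, h). g \<otimes> inv h) p \<in> carrier G - D}"
  have "openin (prod_topology T T) W"
    unfolding W_def by (rule openin_continuous_map_preimage[OF div D])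
  moreover have "(\<one>, \<one>) \<in> W" using \<open>\<one> \<notin> D\<close> by (simp add: W_def)
  ultimately obtain U U' where U: "openin T U" "openin T U'" "\<one> \<in> U" "\<one> \<in> U'" "U \<times> U' \<subseteq> W"
    unfolding openin_prod_topology_alt by meson
  show ?thesis
  proof (rule that[of "U \<inter> U'"])
    show "openin T (U \<inter> U')" "\<one> \<in> U \<inter> U'" using U by auto
    fix V s assume V: "V \<subseteq> U \<inter> U'" and s: "s \<in> carrier G"
    show "(V #> s) \<inter> K = {} \<or> (V #> s) \<inter> L = {}"
    proof (rule ccontr)
      assume "\<not> ?thesis"
      then obtain v w where vw: "v \<in> V" "w \<in> V" "v \<otimes> s \<in> K" "w \<otimes> s \<in> L"
        by (auto simp: r_coset_eq_image)
      then have vwG: "v \<in> carrier G" "w \<in> carrier G"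
        using V openin_subset[OF U(1)] by auto
      have "(v \<otimes> s) \<otimes> inv (w \<otimes> s) = v \<otimes> inv w"
        using vwG s by (simp add: inv_mult_group m_assoc[symmetric]) (simp add: m_assoc)
      then have "v \<otimes> inv w \<in> D" unfolding D_def using vw(3,4) by (intro image_eqI[of _ _ "(v \<otimes> s, w \<otimes> s)"]) auto
      moreover have "(v, w) \<in> W" using U(5) V vw by auto
      ultimately show False by (simp add: W_def)
    qed
  qed
qed

section \<open>Limits along shrinking neighbourhoods of the identity\<close>

definition identity_nhds :: "'a set set" where
  "identity_nhds = {V. openin T V \<and> \<one> \<in> V}"

text \<open>First countability is not among the assumptions on the group at this point, so the limit
  runs along a filter of neighbourhoods instead of a sequence.\<close>

definition shrinking :: "'a set filter" where
  "shrinking = (INF W\<in>identity_nhds. principal {V \<in> identity_nhds. V \<subseteq> W})"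

lemma carrier_identity_nhds: "carrier G \<in> identity_nhds"
  using openin_topspace[of T] by (simp add: identity_nhds_def)

lemma eventually_shrinking:
  "eventually P shrinking \<longleftrightarrow> (\<exists>W\<in>identity_nhds. \<forall>V\<in>identity_nhds. V \<subseteq> W \<longrightarrow> P V)"
  unfolding shrinking_def
proof (subst eventually_INF_base)
  show "identity_nhds \<noteq> {}" using carrier_identity_nhds by blast
  fix U V assume "U \<in> identity_nhds" "V \<in> identity_nhds"
  then show "\<exists>x\<in>identity_nhds. principal {V \<in> identity_nhds. V \<subseteq> x}
      \<le> inf (principal {V \<in> identity_nhds. V \<subseteq> U}) (principal {W \<in> identity_nhds. W \<subseteq> V})"
    by (intro bexI[of _ "U \<inter> V"]) (auto simp: identity_nhds_def)
qed (auto simp: eventually_principal)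

lemma shrinking_not_bot: "shrinking \<noteq> bot"
  unfolding trivial_limit_def eventually_shrinking by blast

text \<open>The content is a cluster point, by Tychonoff, of the normalized covering numbers as the covering
  neighbourhood of the identity shrinks. A closed condition passes to the cluster point even if it only
  holds for small neighbourhoods, as is the case for additivity on disjoint sets.\<close>

lemma Haar_content_exists:
  obtains c :: "'a set \<Rightarrow> real" and K0 where
    "\<And>K. 0 \<le> c K"
    "\<And>K L. compactin T K \<Longrightarrow> compactin T L \<Longrightarrow> K \<subseteq> L \<Longrightarrow> c K \<le> c L"
    "\<And>K L. compactin T K \<Longrightarrow> compactin T L \<Longrightarrow> c (K \<union> L) \<le> c K + c L"
    "\<And>K L. compactin T K \<Longrightarrow> compactin T L \<Longrightarrow> K \<inter> L = {} \<Longrightarrow> c (K \<union> L) = c K + c L"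
    "\<And>K g. compactin T K \<Longrightarrow> g \<in> carrier G \<Longrightarrow> c (K #> g) = c K"
    "compactin T K0" "c K0 = 1"
proof -
  obtain W K0 where W: "openin T W" "\<one> \<in> W" "W \<subseteq> K0" and K0: "compactin T K0"
    using locally_compact unfolding locally_compact_space_def by (metis one_closed topspace_eq)
  \<comment> \<open>Dividing by the index of \<open>K0\<close> forces \<open>c K0 = 1\<close>, which
    later excludes the zero measure; \<open>K0\<close> contains the nonempty open set
    \<open>W\<close>, so the quotients are bounded. Sets that are not compact get the value 0, which
    lies in every interval of \<open>S\<close> below.\<close>
  define r :: "'a set \<Rightarrow> 'a set \<Rightarrow> real" where
    "r V K = (if compactin T K then real (covering_number V K) / real (covering_number V K0) else 0)" for V K
  define S :: "('a set \<Rightarrow> real) set" where "S = (\<Pi>\<^sub>E K\<in>UNIV. {0..real (covering_number W K)})"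
  have nhd: "openin T V \<and> V \<noteq> {}" if "V \<in> identity_nhds" for V
    using that by (auto simp: identity_nhds_def)
  have pos: "covering_number V K0 > 0" if "V \<in> identity_nhds" for V
    using W(2,3) by (intro covering_number_pos K0) (use nhd[OF that] in auto)
  have rS: "r V \<in> S" if "V \<in> identity_nhds" for V
  proof -
    have "real (covering_number V K) \<le> real (covering_number W K) * real (covering_number V K0)"
      if "compactin T K" for K
      using covering_number_le_mult[of V W K0 K] nhd[OF \<open>V \<in> identity_nhds\<close>] W K0 that
      unfolding of_nat_mult[symmetric] of_nat_le_iff by auto
    then show ?thesis
      using pos[OF that] by (auto simp: S_def r_def divide_le_eq)
  qed
  have "compactin (product_topology (\<lambda>K. euclidean) UNIV) S"
    unfolding S_def compactin_PiE by simp
  then have "compact S" by (simp add: euclidean_product_topology)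
  moreover have "filtermap r shrinking \<noteq> bot" using shrinking_not_bot by (simp add: filtermap_bot_iff)
  moreover have "eventually (\<lambda>c. c \<in> S) (filtermap r shrinking)"
    unfolding eventually_filtermap eventually_shrinking using rS carrier_identity_nhds by blast
  ultimately obtain c where c: "c \<in> S" "inf (nhds c) (filtermap r shrinking) \<noteq> bot"
    unfolding compact_filter by blast
  have limit: "P c" if "closed {f. P f}" "V0 \<in> identity_nhds"
    "\<And>V. V \<in> identity_nhds \<Longrightarrow> V \<subseteq> V0 \<Longrightarrow> P (r V)" for P V0
  proof (rule ccontr)
    assume "\<not> P c"
    then have "eventually (\<lambda>f. \<not> P f) (nhds c)"
      using that(1) eventually_nhds_in_open[of "- {f. P f}" c] by (simp add: closed_def)
    moreover have "eventually P (filtermap r shrinking)"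
      unfolding eventually_filtermap eventually_shrinking using that by blast
    ultimately have "eventually (\<lambda>_. False) (inf (nhds c) (filtermap r shrinking))"
      unfolding eventually_inf by blast
    with c(2) show False by (simp add: trivial_limit_def)
  qed
  have top: "V \<subseteq> carrier G" if "V \<in> identity_nhds" for V
    using nhd[OF that] openin_subset by fastforce
  show ?thesis
  proof (rule that[of c K0])
    show "0 \<le> c K" for K using c(1) by (auto simp: S_def)
    show "compactin T K0" by (rule K0)
    show "c K0 = 1"
      by (rule limit[OF _ carrier_identity_nhds])
        (auto intro!: closed_Collect_eq continuous_intros simp: r_def K0 dest!: pos)
    fix K assume K: "compactin T K"
    show "c (K #> g) = c K" if "g \<in> carrier G" for g
      by (rule limit[OF _ carrier_identity_nhds])
        (use nhd in \<open>auto intro!: closed_Collect_eq continuous_intros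
           simp: r_def K compactin_r_coset that covering_number_r_coset\<close>)
    fix L assume L: "compactin T L"
    show "c K \<le> c L" if "K \<subseteq> L"
      by (rule limit[OF _ carrier_identity_nhds])
        (use nhd in \<open>auto intro!: closed_Collect_le continuous_intros divide_right_mono
           simp: r_def K L covering_number_mono that\<close>)
    show "c (K \<union> L) \<le> c K + c L"
    proof (rule limit[OF _ carrier_identity_nhds])
      fix V assume "V \<in> identity_nhds"
      with nhd have "real (covering_number V (K \<union> L)) \<le> real (covering_number V K) + real (covering_number V L)"
        using covering_number_Un[of V K L] K L by (simp flip: of_nat_add)
      then show "r V (K \<union> L) \<le> r V K + r V L"
        by (simp add: r_def K L compactin_Un divide_right_mono flip: add_divide_distrib)
    qed (intro closed_Collect_le continuous_intros continuous_on_product_coordinates)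
    show "c (K \<union> L) = c K + c L" if disj: "K \<inter> L = {}"
    proof -
      obtain V0 where V0: "openin T V0" "\<one> \<in> V0"
        "\<And>V s. V \<subseteq> V0 \<Longrightarrow> s \<in> carrier G \<Longrightarrow> (V #> s) \<inter> K = {} \<or> (V #> s) \<inter> L = {}"
        using compactin_disjoint_separated[OF K L disj] by metis
      show ?thesis
      proof (rule limit[of _ V0])
        fix V assume "V \<in> identity_nhds" "V \<subseteq> V0"
        with nhd have "real (covering_number V (K \<union> L)) = real (covering_number V K) + real (covering_number V L)"
          using covering_number_Un_separated[of V K L] K L V0(3) by (simp flip: of_nat_add)
        then show "r V (K \<union> L) = r V K + r V L"
          by (simp add: r_def K L compactin_Un add_divide_distrib)
      qed (use V0 in \<open>auto simp: identity_nhds_def intro!: closed_Collect_eq continuous_intros\<close>)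
    qed
  qed
qed

text \<open>The measure of a compact set is compared with its content without being identified with
  it. From below, \<open>e K\<close> bounds the measure of \<open>K\<close>, which makes the measure
  nonzero; from above, a compact neighbourhood \<open>L\<close> of \<open>K\<close> bounds it by
  \<open>e L\<close>, which makes it finite. Each invariance claim is proved as an inequality and
  then applied to the inverse element.\<close>

theorem right_Haar_measure_exists:
  obtains M where "sets M = sets (borel_of T)"
    "\<And>A g. A \<in> sets M \<Longrightarrow> g \<in> carrier G \<Longrightarrow> emeasure M (A #> g) = emeasure M A"
    "\<And>K. compactin T K \<Longrightarrow> emeasure M K < \<infinity>"
    "\<And>U. openin T U \<Longrightarrow> emeasure M U = (SUP K\<in>{K. compactin T K \<and> K \<subseteq> U}. emeasure M K)"
    "emeasure M (space M) \<noteq> 0"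
proof -
  obtain c :: "'a set \<Rightarrow> real" and K0 where c:
    "\<And>K. 0 \<le> c K"
    "\<And>K L. compactin T K \<Longrightarrow> compactin T L \<Longrightarrow> K \<subseteq> L \<Longrightarrow> c K \<le> c L"
    "\<And>K L. compactin T K \<Longrightarrow> compactin T L \<Longrightarrow> c (K \<union> L) \<le> c K + c L"
    "\<And>K L. compactin T K \<Longrightarrow> compactin T L \<Longrightarrow> K \<inter> L = {} \<Longrightarrow> c (K \<union> L) = c K + c L"
    "\<And>K g. compactin T K \<Longrightarrow> g \<in> carrier G \<Longrightarrow> c (K #> g) = c K"
    and K0: "compactin T K0" "c K0 = 1"
    by (rule Haar_content_exists) (rule that)
  define e where "e K = ennreal (c K)" for K
  interpret compact_content T e
  proof
    show "e {} = 0" using c(4)[of "{}" "{}"] by (simp add: e_def)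
    fix K L assume K: "compactin T K" and L: "compactin T L"
    show "e K \<le> e L" if "K \<subseteq> L" using c(2)[OF K L that] by (simp add: e_def ennreal_leI)
    show "e (K \<union> L) \<le> e K + e L"
      using c(3)[OF K L] c(1) by (simp add: e_def ennreal_leI flip: ennreal_plus)
    show "e (K \<union> L) = e K + e L" if "K \<inter> L = {}"
      using c(4)[OF K L that] c(1) by (simp add: e_def)
  qed (rule Hausdorff)
  have e_coset: "e (K #> g) = e K" if "compactin T K" "g \<in> carrier G" for K g
    using c(5)[OF that] by (simp add: e_def)
  obtain M where M: "sets M = sets (borel_of T)" "\<And>A. A \<in> sets M \<Longrightarrow> emeasure M A = outer_content T e A"
    using measure_exists by metis
  have open_M: "U \<in> sets M" if "openin T U" for U using that by (simp add: M borel_of_openin)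
  have compact_M: "K \<in> sets M" if "compactin T K" for K
    using that by (simp add: M borel_of_closedin compactin_imp_closedin[OF Hausdorff])
  have MG: "A \<subseteq> carrier G" if "A \<in> sets M" for A
    using that sets.sets_into_space[of A "borel_of T"] by (simp add: M)
  have e_le: "e K \<le> emeasure M K" if "compactin T K" for K
    using that M(2)[OF compact_M[OF that]]
    by (auto simp: outer_content_def intro!: INF_greatest inner_content_upper)
  have inner: "emeasure M U = inner_content T e U" if "openin T U" for U
    using M(2)[OF open_M[OF that]] outer_content_openin[OF that] by simp
  have inner_le: "inner_content T e U \<le> inner_content T e (U #> g)" if "g \<in> carrier G" for U g
    unfolding inner_content_def[of T e U]
    by (rule SUP_least)
      (use that in \<open>auto simp: e_coset[symmetric, of _ g] r_coset_eq_image
         intro!: inner_content_upper compactin_r_coset[unfolded r_coset_eq_image]\<close>)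
  have inner_coset: "inner_content T e (U #> g) = inner_content T e U" if "openin T U" "g \<in> carrier G" for U g
    using inner_le[of g U] inner_le[of "inv g" "U #> g"] that openin_subset[OF that(1)]
    by (simp add: r_coset_cancel)
  have outer_le: "outer_content T e (A #> g) \<le> outer_content T e A" if "g \<in> carrier G" for A g
    unfolding outer_content_def[of T e A]
  proof (rule INF_greatest, clarsimp)
    fix U assume U: "openin T U" "A \<subseteq> U"
    have "outer_content T e (A #> g) \<le> inner_content T e (U #> g)"
      using U that by (intro outer_content_lower openin_r_coset) (auto simp: r_coset_eq_image)
    then show "outer_content T e (A #> g) \<le> inner_content T e U" using inner_coset U that by simp
  qed
  show ?thesis
  proof (rule that[of M])
    show "sets M = sets (borel_of T)" by (rule M)
    show "emeasure M (A #> g) = emeasure M A" if A: "A \<in> sets M" and g: "g \<in> carrier G" for A g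
    proof -
      have "A #> g \<in> sets M" using A g borel_r_coset by (simp add: M(1))
      moreover have "outer_content T e (A #> g) = outer_content T e A"
        using outer_le[of g A] outer_le[of "inv g" "A #> g"] g MG[OF A] by (simp add: r_coset_cancel)
      ultimately show ?thesis using A by (simp add: M(2))
    qed
    show "emeasure M K < \<infinity>" if K: "compactin T K" for K
    proof -
      obtain U L where U: "openin T U" "compactin T L" "K \<subseteq> U" "U \<subseteq> L"
        using locally_compact locally_compact_space_compact_closed_compact[of T] Hausdorff K by metis
      have "emeasure M K \<le> emeasure M U" using U by (intro emeasure_mono open_M)
      also have "\<dots> \<le> e L" unfolding inner[OF U(1)] inner_content_def
        using U by (intro SUP_least mono) auto
      also have "\<dots> < \<infinity>" by (simp add: e_def)
      finally show ?thesis .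
    qed
    show "emeasure M U = (SUP K\<in>{K. compactin T K \<and> K \<subseteq> U}. emeasure M K)" if U: "openin T U" for U
    proof (rule antisym)
      show "emeasure M U \<le> (SUP K\<in>{K. compactin T K \<and> K \<subseteq> U}. emeasure M K)"
        unfolding inner[OF U] inner_content_def using e_le by (intro SUP_mono) auto
      show "(SUP K\<in>{K. compactin T K \<and> K \<subseteq> U}. emeasure M K) \<le> emeasure M U"
        using open_M[OF U] by (auto intro!: SUP_least emeasure_mono)
    qed
    have "1 \<le> emeasure M K0" using e_le[OF K0(1)] K0(2) by (simp add: e_def)
    also have "\<dots> \<le> emeasure M (space M)" by (rule emeasure_space)
    finally show "emeasure M (space M) \<noteq> 0" by auto
  qed
qed

end

section \<open>Continuity of translations in measure\<close>

locale right_Haar = lc_group G T for G (structure) and T +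
  fixes \<mu> :: "'a measure"
  assumes sets_Haar: "sets \<mu> = sets (borel_of T)"
    and emeasure_r_coset: "\<And>A g. A \<in> sets \<mu> \<Longrightarrow> g \<in> carrier G \<Longrightarrow> emeasure \<mu> (A #> g) = emeasure \<mu> A"
    and finite_on_compact: "\<And>K. compactin T K \<Longrightarrow> emeasure \<mu> K < \<infinity>"
    and inner_regular: "\<And>V. openin T V \<Longrightarrow> emeasure \<mu> V = (SUP K\<in>{K. compactin T K \<and> K \<subseteq> V}. emeasure \<mu> K)"
    and Haar_nonzero: "emeasure \<mu> (space \<mu>) \<noteq> 0"
begin

lemma space_Haar [simp]: "space \<mu> = carrier G"
  using sets_eq_imp_space_eq[OF sets_Haar] by simp

lemma openin_sets_Haar: "openin T V \<Longrightarrow> V \<in> sets \<mu>"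
  by (simp add: sets_Haar borel_of_openin)

lemma compactin_sets_Haar: "compactin T K \<Longrightarrow> K \<in> sets \<mu>"
  by (simp add: sets_Haar borel_of_closedin compactin_imp_closedin[OF Hausdorff])

lemma r_coset_sets_Haar: "A \<in> sets \<mu> \<Longrightarrow> g \<in> carrier G \<Longrightarrow> A #> g \<in> sets \<mu>"
  by (simp add: sets_Haar borel_r_coset)

lemma sets_Haar_subset: "A \<in> sets \<mu> \<Longrightarrow> A \<subseteq> carrier G"
  using sets.sets_into_space by fastforce

lemma measure_r_coset: "A \<in> sets \<mu> \<Longrightarrow> g \<in> carrier G \<Longrightarrow> measure \<mu> (A #> g) = measure \<mu> A"
  by (simp add: measure_def emeasure_r_coset)

lemma fmeasurable_r_coset: "A \<in> fmeasurable \<mu> \<Longrightarrow> g \<in> carrier G \<Longrightarrow> A #> g \<in> fmeasurable \<mu>"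
  by (simp add: fmeasurable_def r_coset_sets_Haar emeasure_r_coset)

lemma inj_on_right_translation: "g \<in> carrier G \<Longrightarrow> inj_on (\<lambda>x. x \<otimes> g) (carrier G)"
  by (auto intro!: inj_onI)

lemma r_coset_Diff:
  "A \<subseteq> carrier G \<Longrightarrow> B \<subseteq> carrier G \<Longrightarrow> g \<in> carrier G \<Longrightarrow> (A - B) #> g = (A #> g) - (B #> g)"
  unfolding r_coset_eq_image by (rule inj_on_image_set_diff[OF inj_on_right_translation]) auto

lemma r_coset_Un: "(A \<union> B) #> g = (A #> g) \<union> (B #> g)"
  unfolding r_coset_eq_image by (rule image_Un)

text \<open>For sets of finite measure this is the L1 distance between the indicator functions of
  the two translates.\<close>

definition translate_dist :: "'a set \<Rightarrow> 'a \<Rightarrow> 'a \<Rightarrow> real" where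
  "translate_dist V g h = measure \<mu> (((V #> g) - (V #> h)) \<union> ((V #> h) - (V #> g)))"

lemma translate_dist_r_coset:
  assumes "V \<in> sets \<mu>" "g \<in> carrier G" "h \<in> carrier G" "k \<in> carrier G"
  shows "translate_dist V (g \<otimes> k) (h \<otimes> k) = translate_dist V g h"
proof -
  have V: "V \<subseteq> carrier G" using sets_Haar_subset assms(1) .
  have sub: "V #> g \<subseteq> carrier G" "V #> h \<subseteq> carrier G"
    using r_coset_subset_G[OF V] assms by blast+
  let ?D = "((V #> g) - (V #> h)) \<union> ((V #> h) - (V #> g))"
  have "?D \<in> sets \<mu>" using assms by (auto intro: r_coset_sets_Haar)
  from measure_r_coset[OF this assms(4)] show ?thesis
    using assms V sub unfolding translate_dist_def
    by (simp add: r_coset_Un r_coset_Diff coset_mult_assoc)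
qed

text \<open>\<open>V\<close> is exhausted up to \<open>e / 2\<close> by a compact \<open>K\<close>,
  and Wallace's theorem gives a neighbourhood whose elements \<open>w\<close> all satisfy
  \<open>K #> w \<subseteq> V\<close>. Then \<open>(V #> w) - V\<close> lies in the small set
  \<open>(V - K) #> w\<close>. The opposite difference has the same measure because
  \<open>V #> w\<close> and \<open>V\<close> do.\<close>

lemma translate_dist_one_small:
  assumes V: "openin T V" "V \<in> fmeasurable \<mu>" and e: "e > 0"
  obtains N where "openin T N" "\<one> \<in> N" "\<And>w. w \<in> N \<Longrightarrow> translate_dist V w \<one> < e"
proof -
  have VG: "V \<subseteq> carrier G" using openin_subset[OF V(1)] by simp
  have fin: "emeasure \<mu> V \<noteq> \<infinity>" using fmeasurableD2[OF V(2)] by auto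
  obtain K where K: "compactin T K" "K \<subseteq> V" "measure \<mu> (V - K) < e / 2"
  proof (cases "emeasure \<mu> V = 0")
    case True
    then have "measure \<mu> (V - {}) < e / 2" using e by (simp add: measure_def)
    then show ?thesis by (intro that[of "{}"]) auto
  next
    case False
    then have pos: "measure \<mu> V > 0" using fin by (simp add: measure_def enn2real_positive_iff less_top zero_less_iff_neq_zero)
    \<comment> \<open>Truncation at 0 keeps the real and the extended real comparison equivalent;
      since the measure of \<open>V\<close> is positive, \<open>a\<close> is still strictly below
      it.\<close>
    define a where "a = max 0 (measure \<mu> V - e / 2)"
    have "ennreal a < emeasure \<mu> V"
      using fin e pos by (simp add: emeasure_eq_ennreal_measure a_def ennreal_less_iff)
    then obtain K where K: "compactin T K" "K \<subseteq> V" "ennreal a < emeasure \<mu> K"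
      unfolding inner_regular[OF V(1)] less_SUP_iff by auto
    have fK: "emeasure \<mu> K = ennreal (measure \<mu> K)"
      using finite_on_compact[OF K(1)] by (intro emeasure_eq_ennreal_measure) auto
    with K(3) have "a < measure \<mu> K" by (simp add: a_def ennreal_less_iff)
    moreover have "measure \<mu> (V - K) = measure \<mu> V - measure \<mu> K"
      using compactin_sets_Haar[OF K(1)] K(2) fin openin_sets_Haar[OF V(1)] by (intro measure_Diff) auto
    ultimately have "measure \<mu> (V - K) < e / 2" unfolding a_def by linarith
    with K show ?thesis using that by blast
  qed
  have KG: "K \<subseteq> carrier G" using K(2) VG by blast
  define Q where "Q = {p \<in> topspace (prod_topology T T). (\<lambda>(g, h). g \<otimes> h) p \<in> V}"
  have "openin (prod_topology T T) Q"
    unfolding Q_def by (rule openin_continuous_map_preimage[OF continuous_mult V(1)])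
  moreover have "K \<times> {\<one>} \<subseteq> Q" using K(2) VG KG by (auto simp: Q_def subset_iff)
  moreover have "compactin T {\<one>}" by simp
  ultimately obtain B N where N: "openin T B" "openin T N" "K \<subseteq> B" "{\<one>} \<subseteq> N" "B \<times> N \<subseteq> Q"
    using Wallace_theorem_prod_topology[OF K(1)] by metis
  show ?thesis
  proof (rule that[OF N(2)])
    show "\<one> \<in> N" using N(4) by simp
    fix w assume w: "w \<in> N"
    then have wG: "w \<in> carrier G" using openin_subset[OF N(2)] by auto
    have "K \<times> {w} \<subseteq> Q" using N(3,5) w by blast
    then have KV: "K #> w \<subseteq> V" by (auto simp: Q_def r_coset_eq_image)
    have fV: "V #> w \<in> fmeasurable \<mu>" by (rule fmeasurable_r_coset[OF V(2) wG])
    have "measure \<mu> ((V #> w) - V) \<le> measure \<mu> ((V - K) #> w)"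
    proof (rule measure_mono_fmeasurable)
      show "(V #> w) - V \<subseteq> (V - K) #> w"
        using KV by (auto simp: r_coset_Diff VG KG wG)
      show "(V #> w) - V \<in> sets \<mu>" using fV V by auto
      show "(V - K) #> w \<in> fmeasurable \<mu>"
        using V(2) compactin_sets_Haar[OF K(1)] by (intro fmeasurable_r_coset wG fmeasurable_Diff)
    qed
    also have "\<dots> = measure \<mu> (V - K)"
      using V(2) compactin_sets_Haar[OF K(1)] by (intro measure_r_coset wG) auto
    finally have 1: "measure \<mu> ((V #> w) - V) < e / 2" using K(3) by simp
    have "measure \<mu> ((V #> w) - V) = measure \<mu> (V #> w) - measure \<mu> ((V #> w) \<inter> V)"
      using fV V(2) by (intro measurable_measure_Diff[of "V #> w" \<mu> "(V #> w) \<inter> V", simplified Diff_Int_distrib2 Diff_Int, simplified]) auto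
    moreover have "measure \<mu> (V - (V #> w)) = measure \<mu> V - measure \<mu> ((V #> w) \<inter> V)"
      using fV V(2) by (intro measurable_measure_Diff[of V \<mu> "(V #> w) \<inter> V", simplified Diff_Int_distrib2 Diff_Int, simplified]) auto
    moreover have "measure \<mu> (V #> w) = measure \<mu> V" using V(2) by (intro measure_r_coset wG) auto
    ultimately have 2: "measure \<mu> (V - (V #> w)) < e / 2" using 1 by simp
    have "translate_dist V w \<one> \<le> measure \<mu> ((V #> w) - V) + measure \<mu> (V - (V #> w))"
      unfolding translate_dist_def coset_mult_one[OF VG]
      using fV V(2) by (intro measure_Un_le) auto
    then show "translate_dist V w \<one> < e" using 1 2 by simp
  qed
qed

lemma translate_dist_small:
  assumes V: "openin T V" "V \<in> fmeasurable \<mu>" and e: "e > 0" and h: "h \<in> carrier G"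
  obtains N where "openin T N" "h \<in> N" "\<And>k. k \<in> N \<Longrightarrow> translate_dist V k h < e"
proof -
  obtain N where N: "openin T N" "\<one> \<in> N" "\<And>w. w \<in> N \<Longrightarrow> translate_dist V w \<one> < e"
    by (rule translate_dist_one_small[OF V e]) (rule that)
  show ?thesis
  proof
    show "openin T (N #> h)" by (rule openin_r_coset[OF N(1) h])
    show "h \<in> N #> h" using N(2) h by (force simp: r_coset_eq_image)
    fix k assume "k \<in> N #> h"
    then obtain w where w: "w \<in> N" "k = w \<otimes> h" by (auto simp: r_coset_eq_image)
    then have "w \<in> carrier G" using openin_subset[OF N(1)] by auto
    then have "translate_dist V k h = translate_dist V w \<one>"
      using translate_dist_r_coset[of V w \<one> h] V(2) h w by auto
    then show "translate_dist V k h < e" using N(3)[OF w(1)] by simp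
  qed
qed

lemma measure_translate_diff_le:
  assumes V: "V \<in> fmeasurable \<mu>" and E: "E \<in> sets \<mu>" and g: "g \<in> carrier G" and h: "h \<in> carrier G"
  shows "\<bar>measure \<mu> ((V #> g) \<inter> E) - measure \<mu> ((V #> h) \<inter> E)\<bar> \<le> translate_dist V g h"
proof -
  let ?A = "V #> g" and ?B = "V #> h"
  have f: "?A \<in> fmeasurable \<mu>" "?B \<in> fmeasurable \<mu>" using fmeasurable_r_coset[OF V] g h by auto
  let ?D = "(?A - ?B) \<union> (?B - ?A)"
  have D: "?D \<in> fmeasurable \<mu>" using f by auto
  have le: "measure \<mu> (P \<inter> E) \<le> measure \<mu> (Q \<inter> E) + measure \<mu> ?D"
    if "P \<in> fmeasurable \<mu>" "Q \<in> fmeasurable \<mu>" "P - Q \<subseteq> ?D" for P Q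
  proof -
    have "measure \<mu> (P \<inter> E) \<le> measure \<mu> ((Q \<inter> E) \<union> ?D)"
      using that D E f fmeasurable_Int_fmeasurable[of Q \<mu> E] by (intro measure_mono_fmeasurable) auto
    also have "\<dots> \<le> measure \<mu> (Q \<inter> E) + measure \<mu> ?D"
      using that D E by (intro measure_Un_le) auto
    finally show ?thesis .
  qed
  show ?thesis
    using le[of ?A ?B] le[of ?B ?A] f unfolding translate_dist_def by (simp add: abs_le_iff)
qed

end

lemma (in lc_group) right_Haar_exists: obtains \<mu> where "right_Haar G T \<mu>"
  by (rule right_Haar_measure_exists)
    (intro that right_Haar.intro right_Haar_axioms.intro lc_group_axioms)

section \<open>The space of orbit functions\<close>

text \<open>Bijectivity comes from the action laws, as \<open>inv g\<close> acts as a two-sided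
  inverse of \<open>g\<close>. Extensionality is demanded because the elements of
  \<open>BijGroup E\<close> are extensional.\<close>

lemma group_actionI:
  fixes G (structure)
  assumes "group G"
    and ext: "\<And>g. g \<in> carrier G \<Longrightarrow> \<phi> g \<in> extensional E"
    and closed: "\<And>g x. g \<in> carrier G \<Longrightarrow> x \<in> E \<Longrightarrow> \<phi> g x \<in> E"
    and one: "\<And>x. x \<in> E \<Longrightarrow> \<phi> \<one> x = x"
    and mult: "\<And>g h x. g \<in> carrier G \<Longrightarrow> h \<in> carrier G \<Longrightarrow> x \<in> E \<Longrightarrow> \<phi> (g \<otimes> h) x = \<phi> g (\<phi> h x)"
  shows "group_action G E \<phi>"
proof -
  interpret group G by fact
  have bij: "\<phi> g \<in> Bij E" if g: "g \<in> carrier G" for g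
  proof -
    have "bij_betw (\<phi> g) E E"
      using g closed one mult[of "inv g" g] mult[of g "inv g"]
      by (intro bij_betw_byWitness[of _ "\<phi> (inv g)"]) auto
    then show ?thesis using ext[OF g] by (simp add: Bij_def)
  qed
  have "\<phi> \<in> hom G (BijGroup E)"
  proof (rule homI)
    show "\<phi> g \<in> carrier (BijGroup E)" if "g \<in> carrier G" for g
      using bij[OF that] by (simp add: BijGroup_def)
    fix g h assume gh: "g \<in> carrier G" "h \<in> carrier G"
    have "\<phi> (g \<otimes> h) = compose E (\<phi> g) (\<phi> h)"
    proof
      fix x
      show "\<phi> (g \<otimes> h) x = compose E (\<phi> g) (\<phi> h) x"
        using gh mult ext[of "g \<otimes> h"] by (cases "x \<in> E") (auto simp: compose_def extensional_def)
    qed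
    then show "\<phi> (g \<otimes> h) = \<phi> g \<otimes>\<^bsub>BijGroup E\<^esub> \<phi> h"
      using bij gh by (simp add: BijGroup_def)
  qed
  then have "group_hom G (BijGroup E) \<phi>"
    using group_BijGroup \<open>group G\<close> by (simp add: group_hom_def group_hom_axioms_def)
  then show ?thesis by (simp add: group_action_def)
qed

locale orbit_function_space = right_Haar G T \<mu> for G (structure) and T and \<mu> :: "'a measure" +
  fixes V :: "nat \<Rightarrow> 'a set"
  assumes V_open: "\<And>m. openin T (V m)"
    and V_finite: "\<And>m. V m \<in> fmeasurable \<mu>"
    and separable: "separable_space T"
begin

text \<open>The value at \<open>(h, m, n)\<close> plays the role of \<open>\<mu> {g \<in> V m h. g x \<in> A n}\<close>. Prescribing the value
  \<open>0\<close> outside of the group makes the functions on the whole type unique.\<close>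

definition orbit_functions :: "('a \<times> nat \<times> nat \<Rightarrow> real) set" where
  "orbit_functions = {F.
     (\<forall>h m n. h \<notin> carrier G \<longrightarrow> F (h, m, n) = 0) \<and>
     (\<forall>h m n. 0 \<le> F (h, m, n) \<and> F (h, m, n) \<le> measure \<mu> (V m)) \<and>
     (\<forall>h k m n. h \<in> carrier G \<and> k \<in> carrier G \<longrightarrow> \<bar>F (h, m, n) - F (k, m, n)\<bar> \<le> translate_dist (V m) h k)}"

text \<open>Each defining condition is a closed condition on at most two coordinates, so they cut a
  closed set out of a product of intervals, compact by Tychonoff.\<close>

lemma compact_orbit_functions: "compact orbit_functions"
proof -
  let ?P = "\<Pi>\<^sub>E (p :: 'a \<times> nat \<times> nat)\<in>UNIV. {0..measure \<mu> (V (fst (snd p)))}"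
  have "compactin (product_topology (\<lambda>p::'a \<times> nat \<times> nat. euclidean) UNIV) ?P"
    unfolding compactin_PiE by simp
  then have "compact ?P" by (simp add: euclidean_product_topology)
  moreover have "orbit_functions \<subseteq> ?P" by (auto simp: orbit_functions_def)
  moreover have "closed orbit_functions"
    unfolding orbit_functions_def
    by (intro closed_Collect_conj closed_Collect_all closed_Collect_imp open_Collect_const
        closed_Collect_eq closed_Collect_le continuous_intros continuous_on_product_coordinates)
  ultimately show ?thesis
    using compact_Int_closed[of ?P orbit_functions] by (simp add: Int_absorb1)
qed

text \<open>The ambient product may have uncountably many factors and then is not metrizable. Thanks
  to the common modulus, a function is determined by its values over a countable dense set of
  \<open>h\<close>, and a continuous injection of a compact space into a Hausdorff space is a
  homeomorphism onto its image.\<close>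

lemma orbit_functions_embedding:
  obtains e :: "nat \<Rightarrow> 'a \<times> nat \<times> nat" and r where
    "homeomorphism orbit_functions ((\<lambda>F n. F (e n)) ` orbit_functions) (\<lambda>F n. F (e n)) r"
proof -
  obtain D where D: "countable D" "D \<subseteq> carrier G" "T closure_of D = carrier G"
    using separable by (auto simp: separable_space_def)
  define e where "e = from_nat_into (D \<times> (UNIV :: (nat \<times> nat) set))"
  have "D \<noteq> {}" using D(3) one_closed by auto
  then have e: "range e = D \<times> UNIV"
    unfolding e_def using D(1) by (intro range_from_nat_into) auto
  have "F (h, m, n) = F' (h, m, n)"
    if F: "F \<in> orbit_functions" "F' \<in> orbit_functions" and eq: "\<And>i. F (e i) = F' (e i)" for F F' h m n
  proof (cases "h \<in> carrier G")
    case True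
    have "\<bar>F (h, m, n) - F' (h, m, n)\<bar> \<le> 0 + \<epsilon>" if "\<epsilon> > 0" for \<epsilon> :: real
    proof -
      obtain N where N: "openin T N" "h \<in> N" "\<And>k. k \<in> N \<Longrightarrow> translate_dist (V m) k h < \<epsilon> / 2"
        using \<open>\<epsilon> > 0\<close> by (rule translate_dist_small[OF V_open V_finite half_gt_zero True]) (rule that)
      have "h \<in> T closure_of D" using D(3) True by simp
      then obtain k where k: "k \<in> D" "k \<in> N" using N(1,2) unfolding in_closure_of by blast
      then have "(k, m, n) \<in> range e" using e by simp
      then have "F (k, m, n) = F' (k, m, n)" using eq by auto
      have near: "\<bar>P (k, m, n) - P (h, m, n)\<bar> < \<epsilon> / 2" if "P \<in> orbit_functions" for P
      proof -
        have "k \<in> carrier G" using k(1) D(2) by blast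
        then have "\<bar>P (k, m, n) - P (h, m, n)\<bar> \<le> translate_dist (V m) k h"
          using that True by (simp add: orbit_functions_def)
        with N(3)[OF k(2)] show ?thesis by linarith
      qed
      show ?thesis
        using near[OF F(1)] near[OF F(2)] \<open>F (k, m, n) = F' (k, m, n)\<close> by linarith
    qed
    then have "\<bar>F (h, m, n) - F' (h, m, n)\<bar> \<le> 0" by (rule field_le_epsilon)
    then show ?thesis by simp
  qed (use F in \<open>auto simp: orbit_functions_def\<close>)
  then have "inj_on (\<lambda>F n. F (e n)) orbit_functions"
    by (intro inj_onI ext) (auto simp: fun_eq_iff)
  moreover have "continuous_on orbit_functions (\<lambda>F n. F (e n))"
    by (intro continuous_on_coordinatewise_then_product continuous_on_subset[OF continuous_on_product_coordinates]) auto
  ultimately show ?thesis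
    using homeomorphism_compact[OF compact_orbit_functions _ refl] that by metis
qed

definition nonzero_orbit_functions :: "('a \<times> nat \<times> nat \<Rightarrow> real) set" where
  "nonzero_orbit_functions = orbit_functions - {\<lambda>_. 0}"

abbreviation orbit_space :: "('a \<times> nat \<times> nat \<Rightarrow> real) topology" where
  "orbit_space \<equiv> top_of_set nonzero_orbit_functions"

lemma openin_nonzero_orbit_functions: "openin (top_of_set orbit_functions) nonzero_orbit_functions"
proof -
  have "closed {F :: 'a \<times> nat \<times> nat \<Rightarrow> real. \<forall>p. F p = 0}"
    by (intro closed_Collect_all closed_Collect_eq continuous_intros continuous_on_product_coordinates)
  moreover have "{F :: 'a \<times> nat \<times> nat \<Rightarrow> real. \<forall>p. F p = 0} = {\<lambda>_. 0}" by auto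
  ultimately have "open (- {\<lambda>_. 0 :: real} :: ('a \<times> nat \<times> nat \<Rightarrow> real) set)" by (simp add: open_Compl)
  from openin_open_Int[OF this, of orbit_functions] show ?thesis
    by (simp add: nonzero_orbit_functions_def Diff_eq)
qed

lemma orbit_space_eq: "orbit_space = subtopology (top_of_set orbit_functions) nonzero_orbit_functions"
  by (simp add: subtopology_subtopology nonzero_orbit_functions_def Int_absorb1)

lemma polish_orbit_functions: "polish_topology (top_of_set orbit_functions)"
proof -
  obtain e :: "nat \<Rightarrow> 'a \<times> nat \<times> nat" and r where
    hom: "homeomorphism orbit_functions ((\<lambda>F n. F (e n)) ` orbit_functions) (\<lambda>F n. F (e n)) r"
    by (rule orbit_functions_embedding) (rule that)
  define C where "C = (\<lambda>F n. F (e n)) ` orbit_functions"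
  have "compact C"
    unfolding C_def
    by (rule compact_continuous_image[OF homeomorphism_cont1[OF hom] compact_orbit_functions])
  then have "completely_metrizable_space (top_of_set C)"
    by (intro completely_metrizable_space_closedin completely_metrizable_space_euclidean)
      (simp add: compact_imp_closed)
  moreover have "second_countable (euclidean :: (nat \<Rightarrow> real) topology)"
  proof -
    obtain B :: "(nat \<Rightarrow> real) set set" where B: "countable B" "topological_basis B"
      using ex_countable_basis by blast
    have "\<exists>U\<in>B. x \<in> U \<and> U \<subseteq> O'" if "open O'" "x \<in> O'" for O' and x :: "nat \<Rightarrow> real"
      by (rule topological_basisE[OF B(2) that]) auto
    then show ?thesis
      unfolding second_countable_def using B topological_basis_open[OF B(2)]
      by (intro exI[of _ B]) auto
  qed
  then have "separable_space (top_of_set C)"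
    by (intro second_countable_imp_separable_space second_countable_subtopology)
  moreover have "top_of_set orbit_functions homeomorphic_space top_of_set C"
    using hom unfolding C_def[symmetric] homeomorphic_space_def homeomorphic_maps_def
    by (intro exI[of _ "\<lambda>F n. F (e n)"] exI[of _ r]) (auto simp: homeomorphism_def)
  ultimately show ?thesis
    unfolding polish_topology_def
    using homeomorphic_completely_metrizable_space homeomorphic_separable_space by blast
qed

lemma polish_orbit_space: "polish_topology orbit_space"
  using polish_orbit_functions openin_nonzero_orbit_functions unfolding polish_topology_def orbit_space_eq
  by (blast intro: completely_metrizable_space_openin separable_space_open_subset)

lemma locally_compact_orbit_space: "locally_compact_space orbit_space"
  unfolding orbit_space_eq
proof (rule locally_compact_space_open_subset[OF _ _ openin_nonzero_orbit_functions])
  show "Hausdorff_space (top_of_set orbit_functions) \<or> regular_space (top_of_set orbit_functions)"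
    using polish_orbit_functions by (simp add: polish_topology_metrizable metrizable_imp_Hausdorff_space)
  show "locally_compact_space (top_of_set orbit_functions)"
    using compact_orbit_functions by (simp add: compact_imp_locally_compact_space compact_space_subtopology)
qed

section \<open>The action on orbit functions\<close>

text \<open>Shifting the argument on the right gives a left action. The value 0 off the group is the
  one prescribed in \<open>orbit_functions\<close>.\<close>

definition translate :: "'a \<Rightarrow> ('a \<times> nat \<times> nat \<Rightarrow> real) \<Rightarrow> 'a \<times> nat \<times> nat \<Rightarrow> real" where
  "translate g F = (\<lambda>(h, i). if h \<in> carrier G then F (h \<otimes> g, i) else 0)"

lemma translate_one: "F \<in> orbit_functions \<Longrightarrow> translate \<one> F = F"
  by (auto simp: translate_def orbit_functions_def fun_eq_iff)

lemma translate_mult: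
  "g \<in> carrier G \<Longrightarrow> h \<in> carrier G \<Longrightarrow> translate (g \<otimes> h) F = translate g (translate h F)"
  by (auto simp: translate_def fun_eq_iff m_assoc)

lemma translate_orbit_functions:
  assumes "g \<in> carrier G" "F \<in> orbit_functions"
  shows "translate g F \<in> orbit_functions"
  using assms translate_dist_r_coset[OF fmeasurableD[OF V_finite], symmetric]
  unfolding orbit_functions_def translate_def by auto

lemma translate_nonzero:
  assumes g: "g \<in> carrier G" and F: "F \<in> nonzero_orbit_functions"
  shows "translate g F \<in> nonzero_orbit_functions"
proof -
  have "translate g F \<noteq> (\<lambda>_. 0)"
  proof
    assume *: "translate g F = (\<lambda>_. 0)"
    have "F = translate (inv g) (translate g F)"
      using F g translate_one by (simp add: nonzero_orbit_functions_def flip: translate_mult)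
    also have "\<dots> = (\<lambda>_. 0)" unfolding * by (auto simp: translate_def fun_eq_iff)
    finally show False using F by (simp add: nonzero_orbit_functions_def)
  qed
  then show ?thesis
    using translate_orbit_functions[OF g] F by (simp add: nonzero_orbit_functions_def)
qed

text \<open>The difference is split at \<open>F (h \<otimes> g0, m, n)\<close>. Changing
  \<open>g\<close> to \<open>g0\<close> costs at most \<open>translate_dist\<close>, whatever
  \<open>F\<close> is; changing \<open>F\<close> to \<open>F0\<close> is then a matter of one fixed
  coordinate. The uniformity in \<open>F\<close> is what gives joint rather than separate
  continuity.\<close>

lemma continuous_translate_coordinate:
  assumes h: "h \<in> carrier G"
  shows "continuous_map (prod_topology T orbit_space) euclideanreal (\<lambda>(g, F). F (h \<otimes> g, m, n))"
proof -
  have nbhd: "\<exists>Q. openin (prod_topology T orbit_space) Q \<and> (g0, F0) \<in> Q \<and>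
      (\<forall>(g, F)\<in>Q. \<bar>F (h \<otimes> g, m, n) - F0 (h \<otimes> g0, m, n)\<bar> < \<epsilon>)"
    if g0: "g0 \<in> carrier G" and F0: "F0 \<in> nonzero_orbit_functions" and "\<epsilon> > 0" for g0 F0 and \<epsilon> :: real
  proof -
    have hg0: "h \<otimes> g0 \<in> carrier G" using h g0 by simp
    obtain N where N: "openin T N" "h \<otimes> g0 \<in> N" "\<And>k. k \<in> N \<Longrightarrow> translate_dist (V m) k (h \<otimes> g0) < \<epsilon> / 2"
      using \<open>\<epsilon> > 0\<close> by (rule translate_dist_small[OF V_open V_finite half_gt_zero hg0]) (rule that)
    have "continuous_map T (prod_topology T T) (\<lambda>g. (h, g))"
      using h by (simp add: continuous_map_pairedI)
    from continuous_map_compose[OF this continuous_mult]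
    have "continuous_map T T (\<lambda>g. h \<otimes> g)" by (simp add: o_def)
    from openin_continuous_map_preimage[OF this N(1)]
    have N': "openin T {g \<in> carrier G. h \<otimes> g \<in> N}" by simp
    define B where "B = {F \<in> nonzero_orbit_functions. \<bar>F (h \<otimes> g0, m, n) - F0 (h \<otimes> g0, m, n)\<bar> < \<epsilon> / 2}"
    have "open {F :: 'a \<times> nat \<times> nat \<Rightarrow> real. \<bar>F (h \<otimes> g0, m, n) - F0 (h \<otimes> g0, m, n)\<bar> < \<epsilon> / 2}"
      by (intro open_Collect_less continuous_intros continuous_on_product_coordinates)
    then have B: "openin orbit_space B"
      unfolding B_def by (auto simp: openin_open)
    show ?thesis
    proof (intro exI conjI)
      show "openin (prod_topology T orbit_space) ({g \<in> carrier G. h \<otimes> g \<in> N} \<times> B)"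
        using N' B by (simp add: openin_prod_Times_iff)
      show "(g0, F0) \<in> {g \<in> carrier G. h \<otimes> g \<in> N} \<times> B"
        using g0 F0 N(2) \<open>\<epsilon> > 0\<close> by (simp add: B_def)
      show "\<forall>(g, F)\<in>{g \<in> carrier G. h \<otimes> g \<in> N} \<times> B. \<bar>F (h \<otimes> g, m, n) - F0 (h \<otimes> g0, m, n)\<bar> < \<epsilon>"
      proof clarify
        fix g F assume g: "g \<in> carrier G" "h \<otimes> g \<in> N" and F: "F \<in> B"
        have "\<bar>F (h \<otimes> g, m, n) - F (h \<otimes> g0, m, n)\<bar> \<le> translate_dist (V m) (h \<otimes> g) (h \<otimes> g0)"
          using F g h hg0 by (simp add: B_def nonzero_orbit_functions_def orbit_functions_def)
        moreover have "\<bar>F (h \<otimes> g0, m, n) - F0 (h \<otimes> g0, m, n)\<bar> < \<epsilon> / 2"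
          using F by (simp add: B_def)
        ultimately show "\<bar>F (h \<otimes> g, m, n) - F0 (h \<otimes> g0, m, n)\<bar> < \<epsilon>"
          using N(3)[OF g(2)] by linarith
      qed
    qed
  qed
  show ?thesis
    unfolding mtopology_is_euclidean[symmetric] Met_TC.continuous_map_to_metric
  proof (intro ballI allI impI)
    fix p :: "'a \<times> ('a \<times> nat \<times> nat \<Rightarrow> real)" and \<epsilon> :: real
    assume p: "p \<in> topspace (prod_topology T orbit_space)" and "0 < \<epsilon>"
    obtain g0 F0 where p_eq: "p = (g0, F0)" by (cases p)
    with p obtain Q where Q: "openin (prod_topology T orbit_space) Q" "(g0, F0) \<in> Q"
      "\<forall>(g, F)\<in>Q. \<bar>F (h \<otimes> g, m, n) - F0 (h \<otimes> g0, m, n)\<bar> < \<epsilon>"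
      using nbhd[of g0 F0 \<epsilon>] \<open>0 < \<epsilon>\<close> by auto
    have "(case q of (g, F) \<Rightarrow> F (h \<otimes> g, m, n)) \<in> Met_TC.mball (case p of (g, F) \<Rightarrow> F (h \<otimes> g, m, n)) \<epsilon>"
      if "q \<in> Q" for q
      using Q(3) that by (auto simp: p_eq dist_real_def abs_minus_commute)
    with Q(1,2) p_eq show "\<exists>U. openin (prod_topology T orbit_space) U \<and> p \<in> U \<and>
        (\<forall>y\<in>U. (case y of (g, F) \<Rightarrow> F (h \<otimes> g, m, n)) \<in> Met_TC.mball (case p of (g, F) \<Rightarrow> F (h \<otimes> g, m, n)) \<epsilon>)"
      by blast
  qed
qed

lemma continuous_translate:
  "continuous_map (prod_topology T orbit_space) orbit_space (\<lambda>(g, F). translate g F)"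
proof -
  have "continuous_map (prod_topology T orbit_space) (product_topology (\<lambda>_. euclideanreal) UNIV) (\<lambda>(g, F). translate g F)"
    unfolding continuous_map_componentwise_UNIV
  proof
    fix p :: "'a \<times> nat \<times> nat"
    obtain h m n where p: "p = (h, m, n)" by (cases p) auto
    show "continuous_map (prod_topology T orbit_space) euclideanreal (\<lambda>x. (case x of (g, F) \<Rightarrow> translate g F) p)"
      using continuous_translate_coordinate[of h m n]
      by (cases "h \<in> carrier G") (simp_all add: p translate_def case_prod_unfold)
  qed
  then show ?thesis
    using translate_nonzero
    by (auto simp: euclidean_product_topology continuous_map_in_subtopology)
qed

end

section \<open>The equivariant embedding\<close>

locale orbit_map_setup = orbit_function_space G T \<mu> V
  for G :: "('a, 'c) monoid_scheme" (structure) and T and \<mu> :: "'a measure" and V +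
  fixes M :: "'b measure" and \<alpha> :: "'a \<Rightarrow> 'b \<Rightarrow> 'b" and A :: "nat \<Rightarrow> 'b set"
  assumes V_cover: "(\<Union>m. V m) = carrier G"
    and V_Int_stable: "Int_stable (range V)"
    and V_generates: "sets \<mu> = sigma_sets (carrier G) (range V)"
    and measure_preserving_action: "measure_preserving_action G T M \<alpha>"
    and A_sets: "\<And>n. A n \<in> sets M"
    and A_finite: "\<And>n. emeasure M (A n) < \<infinity>"
    and A_cover: "(\<Union>n. A n) = space M"
    and A_separates: "\<And>x y. x \<in> space M \<Longrightarrow> y \<in> space M \<Longrightarrow> x \<noteq> y \<Longrightarrow> \<exists>n. x \<in> A n \<and> y \<notin> A n"
begin

sublocale action: group_action G "space M" \<alpha>
  using measure_preserving_action by (simp add: measure_preserving_action_def)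

lemma action_closed: "g \<in> carrier G \<Longrightarrow> x \<in> space M \<Longrightarrow> \<alpha> g x \<in> space M"
  using action.element_image by blast

lemma measurable_action: "(\<lambda>(g, x). \<alpha> g x) \<in> \<mu> \<Otimes>\<^sub>M M \<rightarrow>\<^sub>M M"
  using measure_preserving_action unfolding measure_preserving_action_def
  by (simp cong: measurable_cong_sets add: sets_pair_measure_cong[OF sets_Haar refl])

lemma emeasure_action_vimage:
  assumes "g \<in> carrier G" "B \<in> sets M"
  shows "emeasure M {x \<in> space M. \<alpha> g x \<in> B} = emeasure M B"
proof -
  have "\<alpha> g \<in> M \<rightarrow>\<^sub>M M" "distr M M (\<alpha> g) = M"
    using measure_preserving_action assms(1)
    by (auto simp: measure_preserving_action_def measure_preserving_def)
  then have "emeasure M B = emeasure M (\<alpha> g -` B \<inter> space M)"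
    using emeasure_distr[of "\<alpha> g" M M B] assms(2) by simp
  also have "\<alpha> g -` B \<inter> space M = {x \<in> space M. \<alpha> g x \<in> B}" by auto
  finally show ?thesis by simp
qed

sublocale Haar: sigma_finite_measure \<mu>
proof
  show "\<exists>C. countable C \<and> C \<subseteq> sets \<mu> \<and> \<Union>C = space \<mu> \<and> (\<forall>a\<in>C. emeasure \<mu> a \<noteq> \<infinity>)"
    using V_cover fmeasurableD[OF V_finite] fmeasurableD2[OF V_finite]
    by (intro exI[of _ "range V"]) (auto simp: image_subset_iff)
qed

sublocale space: sigma_finite_measure M
proof
  show "\<exists>C. countable C \<and> C \<subseteq> sets M \<and> \<Union>C = space M \<and> (\<forall>a\<in>C. emeasure M a \<noteq> \<infinity>)"
    using A_cover A_sets A_finite by (intro exI[of _ "range A"]) (auto simp: less_top)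
qed

sublocale pair: pair_sigma_finite \<mu> M ..

section \<open>Hitting sets and the orbit map\<close>

definition hits :: "'b \<Rightarrow> nat \<Rightarrow> 'a set" where
  "hits x n = {g \<in> carrier G. \<alpha> g x \<in> A n}"

text \<open>The set to which Tonelli's theorem is applied: its sections at fixed points are hitting
  sets, those at fixed group elements of \<open>B\<close> are preimages of
  \<open>A n\<close>.\<close>

definition hitting_pairs :: "'a set \<Rightarrow> nat \<Rightarrow> ('a \<times> 'b) set" where
  "hitting_pairs B n = {p \<in> space (\<mu> \<Otimes>\<^sub>M M). fst p \<in> B \<and> \<alpha> (fst p) (snd p) \<in> A n}"

lemma hitting_pairs_sets:
  assumes [measurable]: "B \<in> sets \<mu>"
  shows "hitting_pairs B n \<in> sets (\<mu> \<Otimes>\<^sub>M M)"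
proof -
  note A_sets[measurable]
  have [measurable]: "(\<lambda>p. \<alpha> (fst p) (snd p)) \<in> \<mu> \<Otimes>\<^sub>M M \<rightarrow>\<^sub>M M"
    using measurable_action by (simp add: case_prod_unfold)
  show ?thesis unfolding hitting_pairs_def by measurable
qed

lemma hitting_pairs_section:
  assumes "B \<in> sets \<mu>" "x \<in> space M"
  shows "(\<lambda>g. (g, x)) -` hitting_pairs B n = B \<inter> hits x n"
  using assms sets_Haar_subset[OF assms(1)]
  by (auto simp: hitting_pairs_def hits_def space_pair_measure)

lemma hits_sets:
  assumes x: "x \<in> space M"
  shows "hits x n \<in> sets \<mu>"
proof -
  have "space \<mu> \<inter> hits x n \<in> sets \<mu>"
    using sets_Pair2[OF hitting_pairs_sets[OF sets.top], of x n]
    unfolding hitting_pairs_section[OF sets.top x] .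
  then show ?thesis by (simp add: hits_def Int_def)
qed

text \<open>\<open>g\<close> sends \<open>\<alpha> k x\<close> into \<open>A n\<close> exactly when
  \<open>g \<otimes> k\<close> sends \<open>x\<close> there. Moving the point is thus a right
  translation on the group, which \<open>\<mu>\<close> does not notice.\<close>

lemma hits_action:
  assumes "k \<in> carrier G" "x \<in> space M" "B \<subseteq> carrier G"
  shows "(B \<inter> hits (\<alpha> k x) n) #> k = (B #> k) \<inter> hits x n"
proof -
  have "g \<otimes> k \<in> hits x n \<longleftrightarrow> g \<in> hits (\<alpha> k x) n" if "g \<in> carrier G" for g
    using that assms action.composition_rule[OF assms(2) that assms(1)] by (simp add: hits_def)
  then show ?thesis
    using assms(3) unfolding r_coset_eq_image by (force simp: subset_iff)
qed

definition orbit_map :: "'b \<Rightarrow> 'a \<times> nat \<times> nat \<Rightarrow> real" where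
  "orbit_map x = (\<lambda>(h, m, n). if h \<in> carrier G then measure \<mu> ((V m #> h) \<inter> hits x n) else 0)"

lemma V_sets: "V m \<in> sets \<mu>"
  using V_finite by auto

lemma orbit_map_orbit_functions:
  assumes x: "x \<in> space M"
  shows "orbit_map x \<in> orbit_functions"
proof -
  have "measure \<mu> ((V m #> h) \<inter> hits x n) \<le> measure \<mu> (V m)" if "h \<in> carrier G" for h m n
  proof -
    have "measure \<mu> ((V m #> h) \<inter> hits x n) \<le> measure \<mu> (V m #> h)"
      using that x V_sets by (intro measure_mono_fmeasurable fmeasurable_r_coset V_finite)
        (auto intro: r_coset_sets_Haar hits_sets)
    then show ?thesis using that V_sets by (simp add: measure_r_coset)
  qed
  then show ?thesis
    using measure_translate_diff_le[OF V_finite hits_sets[OF x]]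
    unfolding orbit_functions_def orbit_map_def by auto
qed

lemma orbit_map_action:
  assumes k: "k \<in> carrier G" and x: "x \<in> space M"
  shows "orbit_map (\<alpha> k x) = translate k (orbit_map x)"
proof -
  have "measure \<mu> ((V m #> h) \<inter> hits (\<alpha> k x) n) = measure \<mu> ((V m #> (h \<otimes> k)) \<inter> hits x n)"
    if h: "h \<in> carrier G" for h m n
  proof -
    have VG: "V m \<subseteq> carrier G" by (rule sets_Haar_subset[OF V_sets])
    have "(V m #> h) \<inter> hits (\<alpha> k x) n \<in> sets \<mu>"
      using h k x action_closed V_sets by (intro sets.Int r_coset_sets_Haar hits_sets)
    from measure_r_coset[OF this k] show ?thesis
      using r_coset_subset_G[OF VG h] VG h k x by (simp add: hits_action coset_mult_assoc)
  qed
  then show ?thesis using k by (auto simp: orbit_map_def translate_def fun_eq_iff)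
qed

lemma emeasure_hits_eq:
  assumes "h \<in> carrier G" "x \<in> space M"
  shows "emeasure \<mu> ((V m #> h) \<inter> hits x n) = ennreal (orbit_map x (h, m, n))"
proof -
  have "(V m #> h) \<inter> hits x n \<in> fmeasurable \<mu>"
    using assms by (intro fmeasurable_Int_fmeasurable fmeasurable_r_coset V_finite hits_sets)
  then show ?thesis using assms
    by (simp add: orbit_map_def emeasure_eq_measure2)
qed

lemma measurable_orbit_map_coordinate: "(\<lambda>x. orbit_map x p) \<in> borel_measurable M"
proof -
  obtain h m n where p: "p = (h, m, n)" by (cases p) auto
  show ?thesis
  proof (cases "h \<in> carrier G")
    case True
    have B: "V m #> h \<in> sets \<mu>" using True V_sets by (rule r_coset_sets_Haar[rotated])
    have "(\<lambda>x. emeasure \<mu> ((\<lambda>g. (g, x)) -` hitting_pairs (V m #> h) n)) \<in> borel_measurable M"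
      by (rule pair.measurable_emeasure_Pair2[OF hitting_pairs_sets[OF B]])
    then have "(\<lambda>x. enn2real (emeasure \<mu> ((V m #> h) \<inter> hits x n))) \<in> borel_measurable M"
      using B by (intro borel_measurable_enn2real) (simp cong: measurable_cong add: hitting_pairs_section)
    then show ?thesis using True by (simp add: p orbit_map_def measure_def)
  qed (simp add: p orbit_map_def)
qed

text \<open>Integrating over \<open>X\<close> first, each \<open>g\<close> in
  \<open>V m #> h\<close> contributes the measure of \<open>A n\<close>, because the action
  preserves \<open>M\<close>. The integral is therefore the product of two finite measures.\<close>

lemma nn_integral_orbit_map_finite:
  "(\<integral>\<^sup>+ x. ennreal (orbit_map x (h, m, n)) \<partial>M) < \<infinity>"
proof (cases "h \<in> carrier G")
  case True
  let ?B = "V m #> h"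
  have B: "?B \<in> sets \<mu>" using True V_sets by (rule r_coset_sets_Haar[rotated])
  let ?Q = "hitting_pairs ?B n"
  have "(\<integral>\<^sup>+ x. ennreal (orbit_map x (h, m, n)) \<partial>M) = (\<integral>\<^sup>+ x. emeasure \<mu> ((\<lambda>g. (g, x)) -` ?Q) \<partial>M)"
    using True B by (intro nn_integral_cong) (simp add: hitting_pairs_section emeasure_hits_eq)
  also have "\<dots> = emeasure (\<mu> \<Otimes>\<^sub>M M) ?Q"
    by (rule pair.emeasure_pair_measure_alt2[OF hitting_pairs_sets[OF B], symmetric])
  also have "\<dots> = (\<integral>\<^sup>+ g. emeasure M (Pair g -` ?Q) \<partial>\<mu>)"
    by (rule space.emeasure_pair_measure_alt[OF hitting_pairs_sets[OF B]])
  also have "\<dots> = (\<integral>\<^sup>+ g. emeasure M (A n) * indicator ?B g \<partial>\<mu>)"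
  proof (rule nn_integral_cong)
    fix g assume g: "g \<in> space \<mu>"
    then have "Pair g -` ?Q = (if g \<in> ?B then {x \<in> space M. \<alpha> g x \<in> A n} else {})"
      by (auto simp: hitting_pairs_def space_pair_measure)
    then show "emeasure M (Pair g -` ?Q) = emeasure M (A n) * indicator ?B g"
      using g by (simp add: emeasure_action_vimage A_sets)
  qed
  also have "\<dots> = emeasure M (A n) * emeasure \<mu> ?B"
    using B by (rule nn_integral_cmult_indicator)
  also have "\<dots> < \<infinity>"
    using A_finite[of n] fmeasurableD2[OF fmeasurable_r_coset[OF V_finite True], of m]
    by (simp add: ennreal_mult_less_top less_top)
  finally show ?thesis .
qed (simp add: orbit_map_def)

text \<open>If the coordinates at \<open>h = \<one>\<close> vanish, all
  \<open>V m \<inter> hits x n\<close> are null; but these countably many sets cover the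
  group.\<close>

lemma orbit_map_nonzero:
  assumes x: "x \<in> space M"
  shows "orbit_map x \<noteq> (\<lambda>_. 0)"
proof
  assume *: "orbit_map x = (\<lambda>_. 0)"
  have "V m \<inter> hits x n \<in> null_sets \<mu>" for m n
    using emeasure_hits_eq[OF one_closed x, of m n] V_sets hits_sets[OF x] sets_Haar_subset[OF V_sets]
    by (intro null_setsI) (simp_all add: * coset_mult_one)
  then have "(\<Union>m. \<Union>n. V m \<inter> hits x n) \<in> null_sets \<mu>"
    by (intro null_sets_UN)
  moreover have "g \<in> (\<Union>m. \<Union>n. V m \<inter> hits x n)" if g: "g \<in> carrier G" for g
  proof -
    obtain m where "g \<in> V m" using g V_cover by blast
    moreover obtain n where "\<alpha> g x \<in> A n" using action_closed[OF g x] A_cover by blast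
    ultimately have "g \<in> V m \<inter> hits x n" using g by (simp add: hits_def)
    then show ?thesis by blast
  qed
  then have "(\<Union>m. \<Union>n. V m \<inter> hits x n) = space \<mu>"
    by (auto simp: hits_def)
  ultimately show False using Haar_nonzero by (simp add: null_setsD1)
qed

text \<open>The restrictions of \<open>\<mu>\<close> to the two hitting sets agree on the sets
  \<open>V m\<close>, where their values are coordinates at \<open>\<one>\<close>, and hence on all
  Borel sets since \<open>range V\<close> is an intersection-stable generator. Evaluating both on
  the difference of the hitting sets gives the claim.\<close>

lemma hits_diff_null:
  assumes xy: "x \<in> space M" "y \<in> space M" and eq: "orbit_map x = orbit_map y"
  shows "hits x n - hits y n \<in> null_sets \<mu>"
proof -
  let ?N = "\<lambda>z. density \<mu> (indicator (hits z n))"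
  have N: "emeasure (?N z) B = emeasure \<mu> (hits z n \<inter> B)" if "z \<in> space M" "B \<in> sets \<mu>" for z B
    using that hits_sets[OF that(1)] by (simp add: emeasure_density flip: indicator_inter_arith)
  have V: "emeasure (?N z) (V m) = ennreal (orbit_map z (\<one>, m, n))" if "z \<in> space M" for z m
    using that emeasure_hits_eq[OF one_closed that, of m n] V_sets sets_Haar_subset[OF V_sets]
    by (simp add: N coset_mult_one Int_commute)
  have "?N x = ?N y"
  proof (rule measure_eqI_generator_eq[OF V_Int_stable])
    show "range V \<subseteq> Pow (carrier G)" using sets_Haar_subset[OF V_sets] by auto
    show "emeasure (?N x) B = emeasure (?N y) B" if "B \<in> range V" for B
      using that V xy eq by auto
    show "emeasure (?N x) (V i) \<noteq> \<infinity>" for i using V[OF xy(1)] by simp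
  qed (use V_generates V_cover in auto)
  moreover have D: "hits x n - hits y n \<in> sets \<mu>" using xy hits_sets by auto
  ultimately have "emeasure \<mu> (hits x n \<inter> (hits x n - hits y n)) = emeasure \<mu> (hits y n \<inter> (hits x n - hits y n))"
    using N xy by metis
  moreover have "hits x n \<inter> (hits x n - hits y n) = hits x n - hits y n"
    "hits y n \<inter> (hits x n - hits y n) = {}" by blast+
  ultimately show ?thesis using D by (intro null_setsI) simp_all
qed

text \<open>One \<open>g\<close> outside countably many null sets is enough, as
  \<open>\<alpha> g\<close> is injective. One-sided differences suffice because some
  \<open>A n\<close> contains the first of two distinct points and not the second.\<close>

lemma inj_on_orbit_map: "inj_on orbit_map (space M)"
proof (rule inj_onI)
  fix x y assume xy: "x \<in> space M" "y \<in> space M" and eq: "orbit_map x = orbit_map y"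
  have "(\<Union>n. hits x n - hits y n) \<in> null_sets \<mu>"
    using hits_diff_null[OF xy eq] by (intro null_sets_UN)
  then have "space \<mu> \<noteq> (\<Union>n. hits x n - hits y n)" using Haar_nonzero by (metis null_setsD1)
  then obtain g where g: "g \<in> carrier G" "\<And>n. g \<notin> hits x n - hits y n"
    by (auto simp: hits_def)
  then have "\<alpha> g x = \<alpha> g y"
    using A_separates[OF action_closed[OF g(1) xy(1)] action_closed[OF g(1) xy(2)]] by (auto simp: hits_def)
  then show "x = y" using action.inj_prop[OF g(1)] xy by (simp add: inj_on_def)
qed

lemma orbit_map_space: "x \<in> space M \<Longrightarrow> orbit_map x \<in> nonzero_orbit_functions"
  by (simp add: nonzero_orbit_functions_def orbit_map_orbit_functions orbit_map_nonzero)

text \<open>With uncountably many coordinates, measurability of each of them does not by itself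
  control all open sets. The countable embedding turns an open set of orbit functions into a
  condition on a measurable map to a sequence space.\<close>

lemma measurable_orbit_map: "orbit_map \<in> M \<rightarrow>\<^sub>M borel_of orbit_space"
proof -
  obtain e :: "nat \<Rightarrow> 'a \<times> nat \<times> nat" and r where
    hom: "homeomorphism orbit_functions ((\<lambda>F n. F (e n)) ` orbit_functions) (\<lambda>F n. F (e n)) r"
    by (rule orbit_functions_embedding) (rule that)
  let ?r = "\<lambda>F n. F (e n)"
  have meas: "(\<lambda>x. ?r (orbit_map x)) \<in> borel_measurable M"
    by (rule measurable_coordinatewise_then_product) (rule measurable_orbit_map_coordinate)
  have "orbit_map -` W \<inter> space M \<in> sets M" if W: "openin orbit_space W" for W
  proof -
    have "openin (top_of_set orbit_functions) W"
      using W openin_trans_full[OF _ openin_nonzero_orbit_functions] unfolding orbit_space_eq by blast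
    then have "openin (top_of_set (?r ` orbit_functions)) (?r ` W)"
      by (rule homeomorphism_imp_open_map[OF hom])
    then obtain Q where Q: "open Q" "?r ` W = ?r ` orbit_functions \<inter> Q" by (auto simp: openin_open)
    have sub: "W \<subseteq> orbit_functions"
      using openin_subset[OF W] by (auto simp: nonzero_orbit_functions_def)
    have "F \<in> W \<longleftrightarrow> ?r F \<in> Q" if F: "F \<in> orbit_functions" for F
    proof
      assume "?r F \<in> Q"
      then have "?r F \<in> ?r ` W" using Q(2) F by blast
      then obtain F' where F': "F' \<in> W" "?r F = ?r F'" by blast
      then have "F = F'" using F sub homeomorphism_apply1[OF hom] by (metis subsetD)
      then show "F \<in> W" using F' by simp
    qed (use Q(2) in blast)
    then have "orbit_map -` W \<inter> space M = (\<lambda>x. ?r (orbit_map x)) -` Q \<inter> space M"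
      using orbit_map_orbit_functions by auto
    then show ?thesis using measurable_sets[OF meas, of Q] Q(1) by simp
  qed
  then show ?thesis
    unfolding borel_of_def using orbit_map_space
    by (intro measurable_sigma_sets[OF sets_measure_of]) (auto dest: openin_imp_subset)
qed

lemma emeasure_orbit_map_compact:
  assumes K: "compactin orbit_space K"
  shows "emeasure M (orbit_map -` K \<inter> space M) < \<infinity>"
proof -
  define W where "W p k = {F \<in> nonzero_orbit_functions. inverse (real (Suc k)) < F p}" for p k
  have W: "openin orbit_space (W p k)" for p k
  proof -
    have "open {F :: 'a \<times> nat \<times> nat \<Rightarrow> real. inverse (real (Suc k)) < F p}"
      by (intro open_Collect_less continuous_intros continuous_on_product_coordinates)
    then show ?thesis unfolding W_def by (auto simp: openin_open)
  qed
  have "F \<in> (\<Union>p. \<Union>k. W p k)" if "F \<in> K" for F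
  proof -
    have F: "F \<in> nonzero_orbit_functions" using compactin_subset_topspace[OF K] that by auto
    then obtain p where "F p \<noteq> 0" unfolding nonzero_orbit_functions_def by (auto simp: fun_eq_iff)
    then obtain h m n where "F (h, m, n) \<noteq> 0" by (cases p) auto
    moreover have "0 \<le> F (h, m, n)"
      using F by (simp add: nonzero_orbit_functions_def orbit_functions_def)
    ultimately obtain k where "inverse (real (Suc k)) < F (h, m, n)"
      using reals_Archimedean[of "F (h, m, n)"] by auto
    then show ?thesis using F unfolding W_def by blast
  qed
  then have "K \<subseteq> \<Union>(range (case_prod W))" by (auto; blast)
  moreover have "openin orbit_space U" if "U \<in> range (case_prod W)" for U
    using that W by (auto simp: case_prod_unfold)
  ultimately obtain \<F> where "finite \<F>" "\<F> \<subseteq> range (case_prod W)" "K \<subseteq> \<Union>\<F>"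
    using compactinD[OF K, of "range (case_prod W)"] by metis
  then obtain I where I: "finite I" "K \<subseteq> (\<Union>i\<in>I. case_prod W i)"
    using finite_subset_image[of \<F> "case_prod W" UNIV] by auto
  have sets: "orbit_map -` case_prod W i \<inter> space M \<in> sets M" for i
    by (cases i) (auto intro!: measurable_sets[OF measurable_orbit_map] borel_of_openin W)
  have fin: "emeasure M (orbit_map -` case_prod W i \<inter> space M) < \<infinity>" for i
  proof -
    obtain h m n k where i: "i = ((h, m, n), k)" by (cases i) auto
    let ?f = "\<lambda>x. ennreal (orbit_map x (h, m, n))"
    note measurable_orbit_map_coordinate[measurable]
    have f: "?f \<in> borel_measurable M" by measurable
    \<comment> \<open>Multiplying the threshold away brings the set into the form of Markov's
      inequality, whose bound is a multiple of the finite integral of this coordinate.\<close>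
    have "orbit_map -` case_prod W i \<inter> space M
        \<subseteq> {x \<in> space M. 1 \<le> ennreal (real (Suc k)) * ?f x}"
    proof
      fix x assume x: "x \<in> orbit_map -` case_prod W i \<inter> space M"
      then have "inverse (real (Suc k)) < orbit_map x (h, m, n)" by (simp add: i W_def)
      then have "1 \<le> real (Suc k) * orbit_map x (h, m, n)"
        by (simp add: field_simps)
      then have "1 \<le> ennreal (real (Suc k) * orbit_map x (h, m, n))" by simp
      then have "1 \<le> ennreal (real (Suc k)) * ?f x"
        by (simp only: ennreal_mult'[OF of_nat_0_le_iff])
      then show "x \<in> {x \<in> space M. 1 \<le> ennreal (real (Suc k)) * ?f x}"
        using x by simp
    qed
    then have "emeasure M (orbit_map -` case_prod W i \<inter> space M)
        \<le> emeasure M {x \<in> space M. 1 \<le> ennreal (real (Suc k)) * ?f x}"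
      by (intro emeasure_mono) measurable
    also have "\<dots> \<le> ennreal (real (Suc k)) * (\<integral>\<^sup>+ x. ?f x * indicator (space M) x \<partial>M)"
      using nn_integral_Markov_inequality[of ?f "space M" M "ennreal (real (Suc k))"] f by simp
    also have "\<dots> = ennreal (real (Suc k)) * (\<integral>\<^sup>+ x. ?f x \<partial>M)"
      by (simp cong: nn_integral_cong)
    also have "\<dots> < \<infinity>"
      using nn_integral_orbit_map_finite by (simp add: ennreal_mult_less_top)
    finally show ?thesis .
  qed
  have "emeasure M (orbit_map -` K \<inter> space M) \<le> emeasure M (\<Union>i\<in>I. orbit_map -` case_prod W i \<inter> space M)"
  proof (rule emeasure_mono)
    show "orbit_map -` K \<inter> space M \<subseteq> (\<Union>i\<in>I. orbit_map -` case_prod W i \<inter> space M)"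
      using I(2) by blast
  qed (use I(1) sets in \<open>intro sets.finite_UN\<close>)
  also have "\<dots> \<le> (\<Sum>i\<in>I. emeasure M (orbit_map -` case_prod W i \<inter> space M))"
    using I sets by (intro emeasure_subadditive_finite) auto
  also have "\<dots> < \<infinity>" using fin I(1) by simp
  finally show ?thesis .
qed

lemma action_model_real:
  obtains Y :: "real topology" and \<beta> :: "'a \<Rightarrow> real \<Rightarrow> real" and \<Phi> :: "'b \<Rightarrow> real" where
    "polish_topology Y" "locally_compact_space Y" "continuous_action G T Y \<beta>"
    "\<Phi> \<in> M \<rightarrow>\<^sub>M borel_of Y" "inj_on \<Phi> (space M)"
    "\<And>g x. g \<in> carrier G \<Longrightarrow> x \<in> space M \<Longrightarrow> \<Phi> (\<alpha> g x) = \<beta> g (\<Phi> x)"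
    "radon_measure Y (distr M (borel_of Y) \<Phi>)"
    "\<And>g. g \<in> carrier G \<Longrightarrow> measure_preserving (distr M (borel_of Y) \<Phi>) (\<beta> g)"
proof -
  obtain Y :: "real topology" where Y: "orbit_space homeomorphic_space Y" "polish_topology Y"
    by (rule polish_topology_homeomorphic_real[OF polish_orbit_space])
  from Y(1) obtain f f' where "homeomorphic_maps orbit_space Y f f'"
    unfolding homeomorphic_space_def by blast
  then have f: "continuous_map orbit_space Y f" "continuous_map Y orbit_space f'"
    and f'f: "\<And>F. F \<in> nonzero_orbit_functions \<Longrightarrow> f' (f F) = F"
    and ff': "\<And>y. y \<in> topspace Y \<Longrightarrow> f (f' y) = y"
    by (auto simp: homeomorphic_maps_def)
  have f_in: "f F \<in> topspace Y" if "F \<in> nonzero_orbit_functions" for F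
    using continuous_map_image_subset_topspace[OF f(1)] that by auto
  have f'_in: "f' y \<in> nonzero_orbit_functions" if "y \<in> topspace Y" for y
    using continuous_map_image_subset_topspace[OF f(2)] that by auto
  have lc: "locally_compact_space Y"
    using Y(1) locally_compact_orbit_space homeomorphic_locally_compact_space by blast
  \<comment> \<open>The restriction makes \<open>\<beta> g\<close> extensional, as
    \<open>group_action\<close> requires.\<close>
  define \<beta> where "\<beta> g = (\<lambda>y\<in>topspace Y. f (translate g (f' y)))" for g
  define \<Phi> where "\<Phi> x = f (orbit_map x)" for x
  have \<Phi>_in: "\<Phi> x \<in> topspace Y" if "x \<in> space M" for x
    using that by (simp add: \<Phi>_def f_in orbit_map_space)
  have \<beta>_in: "\<beta> g y \<in> topspace Y" if "g \<in> carrier G" "y \<in> topspace Y" for g y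
    using that by (simp add: \<beta>_def f_in f'_in translate_nonzero)
  have "group_action G (topspace Y) \<beta>"
  proof (rule group_actionI)
    show "\<beta> g \<in> extensional (topspace Y)" for g by (simp add: \<beta>_def)
    show "\<beta> \<one> y = y" if "y \<in> topspace Y" for y
      using that f'_in[OF that] by (simp add: \<beta>_def translate_one ff' nonzero_orbit_functions_def)
    show "\<beta> (g \<otimes> h) y = \<beta> g (\<beta> h y)" if "g \<in> carrier G" "h \<in> carrier G" "y \<in> topspace Y" for g h y
      using that by (simp add: \<beta>_def translate_mult f'f f_in f'_in translate_nonzero)
  qed (simp_all add: \<beta>_in is_group)
  moreover have cont: "continuous_map (prod_topology T Y) Y (\<lambda>(g, y). \<beta> g y)"
  proof -
    have "continuous_map (prod_topology T Y) (prod_topology T orbit_space) (\<lambda>(g, y). (g, f' y))"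
      using f(2) by (simp add: continuous_map_prod_top)
    from continuous_map_compose[OF continuous_map_compose[OF this continuous_translate] f(1)]
    show ?thesis
      by (rule continuous_map_eq) (auto simp: \<beta>_def)
  qed
  ultimately have action: "continuous_action G T Y \<beta>" by (simp add: continuous_action_def)
  have "f \<circ> orbit_map \<in> M \<rightarrow>\<^sub>M borel_of Y"
    by (rule measurable_comp[OF measurable_orbit_map continuous_map_borel_measurable[OF f(1)]])
  then have \<Phi>: "\<Phi> \<in> M \<rightarrow>\<^sub>M borel_of Y" by (simp add: \<Phi>_def[abs_def] comp_def)
  have inj: "inj_on \<Phi> (space M)"
    using inj_on_orbit_map f'f orbit_map_space unfolding inj_on_def \<Phi>_def by metis
  have equivariant: "\<Phi> (\<alpha> g x) = \<beta> g (\<Phi> x)" if "g \<in> carrier G" "x \<in> space M" for g x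
    using that by (simp add: \<Phi>_def \<beta>_def orbit_map_action f'f f_in orbit_map_space)
  have radon: "radon_measure Y (distr M (borel_of Y) \<Phi>)"
  proof (rule radon_measureI)
    fix K assume K: "compactin Y K"
    have "K \<in> sets (borel_of Y)"
      using K Y(2) by (intro borel_of_closedin compactin_imp_closedin)
        (auto simp: polish_topology_metrizable metrizable_imp_Hausdorff_space)
    then have "emeasure (distr M (borel_of Y) \<Phi>) K = emeasure M (\<Phi> -` K \<inter> space M)"
      by (rule emeasure_distr[OF \<Phi>])
    also have "\<Phi> -` K \<inter> space M = orbit_map -` (f' ` K) \<inter> space M"
      using compactin_subset_topspace[OF K] ff' f'f orbit_map_space
      unfolding \<Phi>_def by (force simp: image_iff)
    also have "emeasure M (orbit_map -` (f' ` K) \<inter> space M) < \<infinity>"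
      by (rule emeasure_orbit_map_compact[OF image_compactin[OF K f(2)]])
    finally show "emeasure (distr M (borel_of Y) \<Phi>) K < \<infinity>" .
  qed (use Y(2) lc in \<open>simp_all add: polish_topology_metrizable polish_topology_second_countable\<close>)
  have preserving: "measure_preserving (distr M (borel_of Y) \<Phi>) (\<beta> g)" if g: "g \<in> carrier G" for g
  proof -
    have "continuous_map Y (prod_topology T Y) (\<lambda>y. (g, y))"
      using g by (simp add: continuous_map_pairedI)
    from continuous_map_compose[OF this cont] have "continuous_map Y Y (\<beta> g)" by (simp add: o_def)
    then have \<beta>: "\<beta> g \<in> borel_of Y \<rightarrow>\<^sub>M borel_of Y" by (rule continuous_map_borel_measurable)
    have \<alpha>: "\<alpha> g \<in> M \<rightarrow>\<^sub>M M" "distr M M (\<alpha> g) = M"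
      using measure_preserving_action g
      by (auto simp: measure_preserving_action_def measure_preserving_def)
    have "distr (distr M (borel_of Y) \<Phi>) (distr M (borel_of Y) \<Phi>) (\<beta> g)
        = distr (distr M (borel_of Y) \<Phi>) (borel_of Y) (\<beta> g)"
      by (rule distr_cong) simp_all
    also have "\<dots> = distr M (borel_of Y) (\<beta> g \<circ> \<Phi>)" by (rule distr_distr[OF \<beta> \<Phi>])
    \<comment> \<open>Equivariance moves the group element to the other side of
      \<open>\<Phi>\<close>, where it preserves \<open>M\<close>.\<close>
    also have "\<dots> = distr M (borel_of Y) (\<Phi> \<circ> \<alpha> g)"
      by (rule distr_cong) (simp_all add: equivariant g)
    also have "\<dots> = distr (distr M M (\<alpha> g)) (borel_of Y) \<Phi>" by (rule distr_distr[OF \<Phi> \<alpha>(1), symmetric])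
    also have "\<dots> = distr M (borel_of Y) \<Phi>" by (simp add: \<alpha>(2))
    finally show ?thesis
      using \<beta> unfolding measure_preserving_def by simp
  qed
  show ?thesis
    by (rule that[OF Y(2) lc action \<Phi> inj equivariant radon preserving])
qed

end

text \<open>Basic open sets separate points but may have infinite measure, so they are intersected
  with the pieces of a cover by sets of finite measure.\<close>

lemma standard_sigma_finite_separating_sequence:
  assumes "standard_sigma_finite_space M"
  obtains A :: "nat \<Rightarrow> 'a set" where "\<And>n. A n \<in> sets M" "\<And>n. emeasure M (A n) < \<infinity>"
    "(\<Union>n. A n) = space M"
    "\<And>x y. x \<in> space M \<Longrightarrow> y \<in> space M \<Longrightarrow> x \<noteq> y \<Longrightarrow> \<exists>n. x \<in> A n \<and> y \<notin> A n"
proof -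
  interpret sigma_finite_measure M
    using assms by (simp add: standard_sigma_finite_space_def)
  obtain X where X: "polish_topology X" "topspace X = space M" "sets M = sets (borel_of X)"
    using assms unfolding standard_sigma_finite_space_def standard_borel_space_def
    by (elim conjE exE) (rule that)
  obtain B :: "nat \<Rightarrow> 'a set" where B: "\<And>n. openin X (B n)"
    and base: "\<And>U x. openin X U \<Longrightarrow> x \<in> U \<Longrightarrow> \<exists>n. x \<in> B n \<and> B n \<subseteq> U"
  proof (rule second_countable_Int_stable_base[OF polish_topology_second_countable[OF X(1)], where P = "\<lambda>_. True"])
    show "\<exists>U. openin X U \<and> x \<in> U \<and> True" if "x \<in> topspace X" for x
      using that openin_topspace by blast
    fix W :: "nat \<Rightarrow> 'a set"
    assume "\<And>n. openin X (W n)" "\<And>U x. openin X U \<Longrightarrow> x \<in> U \<Longrightarrow> \<exists>n. x \<in> W n \<and> W n \<subseteq> U"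
    then show thesis by (rule that)
  qed simp_all
  obtain C :: "nat \<Rightarrow> 'a set" where C: "range C \<subseteq> sets M" "(\<Union>i. C i) = space M" "\<And>i. emeasure M (C i) \<noteq> \<infinity>"
    using sigma_finite by metis
  define A where "A n = B (fst (prod_decode n)) \<inter> C (snd (prod_decode n))" for n
  have A: "A (prod_encode (i, j)) = B i \<inter> C j" for i j by (simp add: A_def)
  have B_sets: "B n \<in> sets M" for n unfolding X(3) by (rule borel_of_openin[OF B])
  \<comment> \<open>Used twice: with the whole space as \<open>U\<close> it gives the cover, with a
    \<open>U\<close> that contains \<open>x\<close> but not \<open>y\<close> the separation.\<close>
  have near: "\<exists>n. x \<in> A n \<and> A n \<subseteq> U" if U: "openin X U" "x \<in> U" for U x
  proof -
    have "x \<in> space M" using openin_subset[OF U(1)] U(2) X(2) by blast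
    then obtain j where "x \<in> C j" unfolding C(2)[symmetric] by blast
    moreover obtain i where "x \<in> B i" "B i \<subseteq> U" using base[OF U] by blast
    ultimately show ?thesis using A[of i j] by (intro exI[of _ "prod_encode (i, j)"]) auto
  qed
  show ?thesis
  proof (rule that)
    show A_sets: "A n \<in> sets M" for n unfolding A_def using B_sets C(1) by auto
    show "emeasure M (A n) < \<infinity>" for n
    proof (rule order_le_less_trans)
      show "emeasure M (A n) \<le> emeasure M (C (snd (prod_decode n)))"
        unfolding A_def using C(1) by (intro emeasure_mono) auto
      show "\<dots> < \<infinity>" using C(3) by (simp add: less_top)
    qed
    show "(\<Union>n. A n) = space M"
    proof (rule antisym)
      show "(\<Union>n. A n) \<subseteq> space M" by (intro UN_least sets.sets_into_space A_sets)
      show "space M \<subseteq> (\<Union>n. A n)"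
        using near[OF openin_topspace] unfolding X(2) by (meson UN_iff UNIV_I subsetI)
    qed
    fix x y assume xy: "x \<in> space M" "y \<in> space M" "x \<noteq> y"
    have "Hausdorff_space X"
      using X(1) by (simp add: polish_topology_metrizable metrizable_imp_Hausdorff_space)
    then obtain U where "openin X U" "x \<in> U" "y \<notin> U"
      using xy unfolding Hausdorff_space_def X(2) disjnt_iff by metis
    then show "\<exists>n. x \<in> A n \<and> y \<notin> A n" using near by blast
  qed
qed

theorem theorem2:
  fixes G :: "('g, 'm) monoid_scheme" and T :: "'g topology"
    and M :: "'a measure" and \<alpha> :: "'g \<Rightarrow> 'a \<Rightarrow> 'a"
  assumes "standard_sigma_finite_space M"
    and "polish_group G T" and "locally_compact_space T"
    and "measure_preserving_action G T M \<alpha>"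
  shows "\<exists>(Y :: real topology) (\<beta> :: 'g \<Rightarrow> real \<Rightarrow> real) (\<Phi> :: 'a \<Rightarrow> real).
           polish_topology Y \<and> locally_compact_space Y \<and>
           continuous_action G T Y \<beta> \<and>
           \<Phi> \<in> M \<rightarrow>\<^sub>M borel_of Y \<and> inj_on \<Phi> (space M) \<and>
           (\<forall>g\<in>carrier G. \<forall>x\<in>space M. \<Phi> (\<alpha> g x) = \<beta> g (\<Phi> x)) \<and>
           radon_measure Y (distr M (borel_of Y) \<Phi>) \<and>
           (\<forall>g\<in>carrier G. measure_preserving (distr M (borel_of Y) \<Phi>) (\<beta> g))"
proof -
  have T: "topological_group G T" "polish_topology T"
    using assms(2) by (simp_all add: polish_group_def)
  interpret lc_group G T
    using T assms(3)
    by unfold_locales (simp_all add: polish_topology_metrizable metrizable_imp_Hausdorff_space)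
  obtain \<mu> where "right_Haar G T \<mu>" by (rule right_Haar_exists)
  then interpret right_Haar G T \<mu> .
  \<comment> \<open>One family plays both roles: its members have finite measure, so translation is
    continuous on them, and it is an intersection-stable generator of the Borel sets.\<close>
  obtain V :: "nat \<Rightarrow> 'g set" where V: "\<And>n. openin T (V n)" "\<And>n. V n \<in> fmeasurable \<mu>" "Int_stable (range V)"
    and base: "\<And>U x. openin T U \<Longrightarrow> x \<in> U \<Longrightarrow> \<exists>n. x \<in> V n \<and> V n \<subseteq> U"
  proof (rule second_countable_Int_stable_base[OF polish_topology_second_countable[OF T(2)],
        where P = "\<lambda>U. U \<in> fmeasurable \<mu>"])
    fix W :: "nat \<Rightarrow> 'g set"
    assume "\<And>n. openin T (W n)" "\<And>n. W n \<in> fmeasurable \<mu>" "Int_stable (range W)"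
      "\<And>U x. openin T U \<Longrightarrow> x \<in> U \<Longrightarrow> \<exists>n. x \<in> W n \<and> W n \<subseteq> U"
    then show thesis by (rule that)
  next
    fix g assume "g \<in> topspace T"
    then obtain U K where U: "openin T U" "compactin T K" "g \<in> U" "U \<subseteq> K"
      using assms(3) unfolding locally_compact_space_def by blast
    have "emeasure \<mu> U \<le> emeasure \<mu> K" using U compactin_sets_Haar by (intro emeasure_mono)
    then have "U \<in> fmeasurable \<mu>"
      using finite_on_compact[OF U(2)] openin_sets_Haar[OF U(1)]
      by (intro fmeasurableI) (auto intro: le_less_trans)
    with U show "\<exists>U. openin T U \<and> g \<in> U \<and> U \<in> fmeasurable \<mu>" by blast
  next
    fix U W assume "openin T W" "W \<subseteq> U" "U \<in> fmeasurable \<mu>"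
    then show "W \<in> fmeasurable \<mu>" using fmeasurableI2 openin_sets_Haar by blast
  qed simp
  obtain A :: "nat \<Rightarrow> 'a set" where A: "\<And>n. A n \<in> sets M" "\<And>n. emeasure M (A n) < \<infinity>"
    "(\<Union>n. A n) = space M"
    "\<And>x y. x \<in> space M \<Longrightarrow> y \<in> space M \<Longrightarrow> x \<noteq> y \<Longrightarrow> \<exists>n. x \<in> A n \<and> y \<notin> A n"
    by (rule standard_sigma_finite_separating_sequence[OF assms(1)]) (rule that)
  have "(\<Union>m. V m) = carrier G"
  proof (rule antisym)
    show "(\<Union>m. V m) \<subseteq> carrier G" using openin_subset[OF V(1)] by auto
    show "carrier G \<subseteq> (\<Union>m. V m)"
      using base[OF openin_topspace] unfolding topspace_eq by (meson UN_iff UNIV_I subsetI)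
  qed
  moreover have "sets \<mu> = sigma_sets (carrier G) (range V)"
    using sets_borel_of_base[OF V(1) base] by (simp add: sets_Haar)
  ultimately interpret orbit_map_setup G T \<mu> V M \<alpha> A
    using V A T(2) assms(4)
    by unfold_locales (simp_all add: polish_topology_def)
  show ?thesis
    by (rule action_model_real) blast
qed

end
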